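(* Let $p \geq 1$ be an integer, $c = 2p+1$, and let $n$ be an integer with $2 \leq n \leq p-2$. Then $r(S_c(n,2)) \leq n+3p+3$.
   Context: For integers $n \geq m \geq 0$ and $c \geq 1$, the linked double star $S_c(n,m)$ is the graph on vertices $a_1,\dots,a_c, v_1,\dots,v_n, w_1,\dots,w_m$ with edges $a_1v_i$ ($1\le i\le n$), $a_ja_{j+1}$ ($1 \le j \le c-1$) and $a_cw_j$ ($1\le j\le m$); in particular $S_c(n,2)$ requires $n \ge 2$. The ramsey number $r(G)$ is the least integer $r$ such that every 2-coloring of the edges of $K_r$ contains a monochromatic copy of $G$. *)

theory Defs
  imports "HOL-Library.Ramsey"
begin

text \<open>A graph is a pair of a vertex set and a set of edges, where edges are two-element sets of
  vertices.\<close>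

type_synonym 'a graph = "'a set \<times> 'a set set"

definition simple_graph :: "'a graph \<Rightarrow> bool" where
  "simple_graph G \<longleftrightarrow> finite (fst G) \<and> snd G \<subseteq> [fst G]\<^bsup>2\<^esup>"

definition mono_copy :: "'a graph \<Rightarrow> nat \<Rightarrow> (nat set \<Rightarrow> nat) \<Rightarrow> bool" where
  "mono_copy G r f \<longleftrightarrow>
     (\<exists>i<2. \<exists>\<phi>. inj_on \<phi> (fst G) \<and> \<phi> ` fst G \<subseteq> {..<r} \<and> (\<forall>e\<in>snd G. f (\<phi> ` e) = i))"

text \<open>A 2-colouring of the edges of the complete graph on \<open>{..<r}\<close> is a function on
  \<open>[{..<r}]\<^bsup>2\<^esup>\<close> with values in \<open>{..<2}\<close>; its values elsewhere are irrelevant.\<close>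

definition ramsey_number :: "'a graph \<Rightarrow> nat" where
  "ramsey_number G = (LEAST r. \<forall>f \<in> [{..<r}]\<^bsup>2\<^esup> \<rightarrow> {..<2}. mono_copy G r f)"

datatype star_vertex = A nat | V nat | W nat

text \<open>The graph \<open>S\<^sub>c(n,m)\<close>; only meaningful for \<open>c \<ge> 1\<close>.\<close>

definition linked_double_star :: "nat \<Rightarrow> nat \<Rightarrow> nat \<Rightarrow> star_vertex graph" where
  "linked_double_star c n m =
     (A ` {1..c} \<union> V ` {1..n} \<union> W ` {1..m},
      {{A 1, V i} |i. i \<in> {1..n}} \<union> {{A j, A (j + 1)} |j. j \<in> {1..<c}} \<union>
      {{A c, W j} |j. j \<in> {1..m}})"

lemma simple_graph_linked_double_star:
  assumes "c \<ge> 1"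
  shows "simple_graph (linked_double_star c n m)"
  using assms by (auto simp: simple_graph_def linked_double_star_def)

text \<open>By Ramsey's theorem, the set whose least element is taken in the definition of
  \<open>ramsey_number\<close> is nonempty.\<close>

lemma ramsey_number_exists:
  assumes "simple_graph G"
  shows "\<exists>r. \<forall>f \<in> [{..<r}]\<^bsup>2\<^esup> \<rightarrow> {..<2}. mono_copy G r f"
proof -
  let ?k = "card (fst G)"
  obtain N :: nat where N: "partn_lst {..<N} [?k, ?k] 2"
    using ramsey_full by blast
  have "mono_copy G N f" if f: "f \<in> [{..<N}]\<^bsup>2\<^esup> \<rightarrow> {..<2}" for f
  proof -
    have "f \<in> [{..<N}]\<^bsup>2\<^esup> \<rightarrow> {..<length [?k, ?k]}"
      using f by (simp add: numeral_2_eq_2)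
    with N obtain i H where i: "i < length [?k, ?k]" and H: "H \<in> [{..<N}]\<^bsup>([?k, ?k] ! i)\<^esup>"
      and mono: "f ` [H]\<^bsup>2\<^esup> \<subseteq> {i}"
      by (rule partn_lstE) auto
    have i2: "i < 2" and "[?k, ?k] ! i = ?k"
      using i by (auto simp: less_Suc_eq)
    with H have "H \<subseteq> {..<N}" "finite H" "card H = ?k"
      by (auto simp: nsets_def)
    then obtain \<phi> where \<phi>: "bij_betw \<phi> (fst G) H"
      using assms by (metis simple_graph_def finite_same_card_bij)
    have "f (\<phi> ` e) = i" if "e \<in> snd G" for e
    proof -
      have "\<phi> ` e \<in> [H]\<^bsup>2\<^esup>"
        using bij_betw_nsets[OF \<phi>, of 2] that assms
        by (auto simp: simple_graph_def bij_betw_def)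
      then show ?thesis using mono by blast
    qed
    then show ?thesis
      using i2 \<phi> \<open>H \<subseteq> {..<N}\<close> unfolding mono_copy_def bij_betw_def by blast
  qed
  then show ?thesis by blast
qed

end

theory Submission
  imports Defs
begin

text \<open>Put \<open>q = p + 1\<close>, so that \<open>K\<^sub>N\<close> with \<open>N = n + 3q\<close> is to be coloured and \<open>n + 3 \<le> q\<close>. The main
  tool is a theorem of Jackson: if every vertex of \<open>X\<close> has at least \<open>k\<close> neighbours in \<open>Y\<close>,
  \<open>|X| \<le> k\<close> and \<open>|Y| \<le> 2k - 2\<close>, then some cycle alternates between \<open>X\<close> and \<open>Y\<close> and covers \<open>X\<close>.

  There is a monochromatic cycle of length \<open>2q\<close>. To see this, take a longest monochromatic cycle
  \<open>C\<close> of length at most \<open>2q\<close>, say red. No vertex outside has two consecutive red neighbours on \<open>C\<close>,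
  and Jackson's theorem bounds the number of vertices outside with many blue neighbours on \<open>C\<close>. So
  many vertices outside are red to about every other vertex of \<open>C\<close>. If \<open>|C|\<close> is even, they form a
  blue clique with the remaining vertices of \<open>C\<close>, and Jackson's theorem gives a longer blue cycle; if
  \<open>|C|\<close> is odd, they can be inserted into \<open>C\<close>.

  Now let \<open>C\<close> be a red cycle of length \<open>2q\<close>, let \<open>R\<close> be its complement, let \<open>L\<close> be the set of
  vertices of \<open>C\<close> with more than \<open>n\<close> red neighbours in \<open>R\<close>, and let \<open>F = C - L\<close>. If \<open>|L| < q - n\<close>,
  then the blue graph between \<open>F\<close> and \<open>R\<close> contains the double star. Otherwise, for \<open>x\<close> in \<open>L\<close>, the
  vertex at distance two from \<open>x\<close> on \<open>C\<close> is completely blue to \<open>R\<close>, unless walking around \<open>C\<close> from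
  \<open>x\<close> to that vertex gives a red double star. So there are many such blue vertices. In \<open>F\<close> and \<open>R\<close>
  they give a blue double star as soon as one of them has one further blue neighbour; if none has,
  then they are joined in red to \<open>C\<close> or at least to \<open>L\<close>, and there is a red double star.\<close>

subsection \<open>Paths and cycles\<close>

text \<open>With a symmetric \<open>G\<close>, two adjacent vertices already form a cycle in this
  sense; genuine cycles are obtained through lower bounds on the length.\<close>

definition cycle :: "('a \<Rightarrow> 'a \<Rightarrow> bool) \<Rightarrow> 'a list \<Rightarrow> bool" where
  "cycle G L \<longleftrightarrow> L \<noteq> [] \<and> distinct L \<and> successively G L \<and> G (last L) (hd L)"

lemma cycle_append_commute:
  assumes "cycle G (xs @ ys)"
  shows "cycle G (ys @ xs)"
  using assms by (cases "xs = []"; cases "ys = []") (auto simp: cycle_def successively_append_iff)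

lemma cycle_rotate:
  assumes "cycle G L"
  shows "cycle G (rotate k L)"
  by (simp add: assms cycle_append_commute rotate_drop_take)

lemma cycle_mono:
  assumes "cycle G L" and "\<And>u v. G u v \<Longrightarrow> H u v"
  shows "cycle H L"
  using assms unfolding cycle_def by (metis (mono_tags, lifting) successively_mono)

lemma cycle_nth:
  assumes "cycle G L" and "i < length L"
  shows "G (L ! i) (L ! (Suc i mod length L))"
proof (cases "Suc i < length L")
  case True
  then show ?thesis using assms by (simp add: cycle_def successively_conv_nth)
next
  case False
  then have "Suc i = length L" using assms by simp
  then show ?thesis using assms
    by (metis cycle_def diff_Suc_1 hd_conv_nth last_conv_nth mod_self)
qed

lemma cycle_start_at:
  assumes "cycle G L" and "v \<in> set L"
  obtains M where "cycle G (v # M)" and "set (v # M) = set L" and "length (v # M) = length L"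
proof -
  obtain xs ys where L: "L = xs @ v # ys" using assms(2) by (meson split_list)
  have "cycle G (v # ys @ xs)" using cycle_append_commute[of G xs "v # ys"] assms(1) L by simp
  then show ?thesis using that[of "ys @ xs"] L by auto
qed

lemma cycle_conj:
  assumes "cycle G L" and "cycle H L"
  shows "cycle (\<lambda>u v. G u v \<and> H u v) L"
  using assms by (auto simp: cycle_def successively_conv_nth)

lemma successively_const:
  assumes "successively (\<lambda>u v. Q u \<longleftrightarrow> Q v) L" and "v \<in> set L"
  shows "Q v \<longleftrightarrow> Q (hd L)"
  using assms by (induction L) (auto simp: successively_Cons split: if_splits)

text \<open>\<open>rotate1 L ! i\<close> is the cyclic successor of \<open>L ! i\<close>, so the
  closing edge is covered by the same hypothesis as all others.\<close>

lemma cycleI_nth: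
  assumes "L \<noteq> []" "distinct L" "\<And>i. i < length L \<Longrightarrow> G (L ! i) (rotate1 L ! i)"
  shows "cycle G L"
proof -
  have rot1: "rotate1 L ! i = L ! (Suc i mod length L)" if "i < length L" for i
    using that nth_rotate[of i L 1] by simp
  have "G (L ! i) (L ! Suc i)" if "Suc i < length L" for i
    using assms(3)[of i] rot1[of i] that by simp
  moreover have "G (last L) (hd L)"
    using assms(1) assms(3)[of "length L - 1"] rot1[of "length L - 1"]
    by (simp add: last_conv_nth hd_conv_nth)
  ultimately show ?thesis using assms by (auto simp: cycle_def successively_conv_nth)
qed

text \<open>The positions whose vertex lies in \<open>N\<close> and the positions whose successor
  lies in \<open>N\<close> are disjoint and equally many. With \<open>k <= card N\<close> they fill
  all \<open>2 * k\<close> positions, so exactly one of any two neighbours on the cycle lies in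
  \<open>N\<close>.\<close>

lemma independent_half_of_cycle:
  assumes L: "cycle G L" "length L = 2 * k" and ind: "\<And>i. i < length L \<Longrightarrow> \<not> (L ! i \<in> N \<and> rotate1 L ! i \<in> N)"
    and N: "N \<subseteq> set L" "k \<le> card N"
  shows "cycle (\<lambda>u v. u \<in> N \<longleftrightarrow> v \<notin> N) L" and "card N = k"
proof -
  have bij: "card {i. i < length L \<and> K ! i \<in> N} = card N" if K: "distinct K" "set K = set L" "length K = length L" for K
  proof (rule bij_betw_same_card)
    show "bij_betw ((!) K) {i. i < length L \<and> K ! i \<in> N} N"
      unfolding bij_betw_def
    proof
      show "inj_on ((!) K) {i. i < length L \<and> K ! i \<in> N}"
        using K by (auto simp: inj_on_def nth_eq_iff_index_eq)
      show "(!) K ` {i. i < length L \<and> K ! i \<in> N} = N"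
      proof
        show "N \<subseteq> (!) K ` {i. i < length L \<and> K ! i \<in> N}"
        proof
          fix v assume v: "v \<in> N"
          then obtain i where "i < length K" "v = K ! i" using N(1) K(2) by (metis in_set_conv_nth subsetD)
          then show "v \<in> (!) K ` {i. i < length L \<and> K ! i \<in> N}" using v K(3) by auto
        qed
      qed auto
    qed
  qed
  let ?I = "{i. i < length L \<and> L ! i \<in> N}" and ?J = "{i. i < length L \<and> rotate1 L ! i \<in> N}"
  have "distinct L" "L \<noteq> []" using L by (auto simp: cycle_def)
  then have "card ?I = card N" "card ?J = card N" using bij[of L] bij[of "rotate1 L"] by simp_all
  moreover have "card (?I \<union> ?J) = card ?I + card ?J"
    using ind by (intro card_Un_disjoint) auto
  ultimately have cIJ: "card (?I \<union> ?J) = 2 * card N" by simp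
  have sub: "?I \<union> ?J \<subseteq> {..<length L}" by auto
  have "card (?I \<union> ?J) \<le> 2 * k" using card_mono[OF _ sub] L by simp
  then show "card N = k" using cIJ N(2) by linarith
  then have "card {..<length L} \<le> card (?I \<union> ?J)" using cIJ L by simp
  then have "?I \<union> ?J = {..<length L}" using sub by (intro card_seteq) auto
  then show "cycle (\<lambda>u v. u \<in> N \<longleftrightarrow> v \<notin> N) L"
    using ind \<open>distinct L\<close> \<open>L \<noteq> []\<close> by (intro cycleI_nth) blast+
qed

text \<open>Each of the \<open>s\<close> consecutive pairs holds at most one
  \<open>Q\<close>-vertex. If all hold one, then a pair that uses its second vertex forces the next
  pair to do the same; \<open>j\<close> is the first such pair, or \<open>s\<close> if there is
  none.\<close>

lemma independent_half_of_path:
  assumes "successively (\<lambda>u v. \<not> (Q u \<and> Q v)) L" and "length L = 2 * s"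
  shows "length (filter Q L) \<le> s \<and>
    (length (filter Q L) = s \<longrightarrow>
      (\<exists>j\<le>s. \<forall>p<s. (p < j \<longrightarrow> Q (L ! (2 * p))) \<and> (j \<le> p \<longrightarrow> Q (L ! (2 * p + 1)))))"
  using assms
proof (induction s arbitrary: L)
  case 0
  then show ?case by simp
next
  case (Suc s)
  then obtain a b M where L: "L = a # b # M"
    by (cases L; cases "tl L") auto
  have M: "successively (\<lambda>u v. \<not> (Q u \<and> Q v)) M" "length M = 2 * s" "\<not> (Q a \<and> Q b)"
    "M \<noteq> [] \<Longrightarrow> \<not> (Q b \<and> Q (hd M))"
    using Suc.prems L by (auto simp: successively_Cons)
  note IH = Suc.IH[OF M(1,2)]
  have le: "length (filter Q L) \<le> Suc s" using IH M(3) L by auto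
  moreover have "\<exists>j\<le>Suc s. \<forall>p<Suc s. (p < j \<longrightarrow> Q (L ! (2 * p))) \<and> (j \<le> p \<longrightarrow> Q (L ! (2 * p + 1)))"
    if eq: "length (filter Q L) = Suc s"
  proof -
    have "length (filter Q M) = s" and ab: "Q a \<or> Q b" using eq IH M(3) L by (auto split: if_splits)
    then obtain j where j: "j \<le> s" "\<forall>p<s. (p < j \<longrightarrow> Q (M ! (2 * p))) \<and> (j \<le> p \<longrightarrow> Q (M ! (2 * p + 1)))"
      using IH by blast
    show ?thesis
    proof (cases "Q a")
      case True
      have "(p < Suc j \<longrightarrow> Q (L ! (2 * p))) \<and> (Suc j \<le> p \<longrightarrow> Q (L ! (2 * p + 1)))" if "p < Suc s" for p
        using that j True L by (cases p) auto
      then show ?thesis using j(1) by (intro exI[of _ "Suc j"]) auto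
    next
      case False
      then have Qb: "Q b" using ab by simp
      have "j = 0"
      proof (rule ccontr)
        assume "j \<noteq> 0"
        then have "s > 0" "Q (M ! 0)" using j by auto
        moreover have "M \<noteq> []" using M(2) \<open>s > 0\<close> by auto
        ultimately show False using M(4) Qb by (simp add: hd_conv_nth)
      qed
      then have "Q (L ! (2 * p + 1))" if "p < Suc s" for p
        using that j Qb L by (cases p) auto
      then show ?thesis by (intro exI[of _ 0]) auto
    qed
  qed
  ultimately show ?case by blast
qed


subsection \<open>Alternating cycles in bipartite graphs\<close>

locale bipartite =
  fixes H :: "'a \<Rightarrow> 'a \<Rightarrow> bool" and X Y :: "'a set"
  assumes finite_X: "finite X" and finite_Y: "finite Y" and disjoint: "X \<inter> Y = {}"
begin

text \<open>\<open>H\<close> is read from \<open>X\<close> to \<open>Y\<close> only, so it may be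
  asymmetric; \<open>star_in_dense_bipartite\<close> uses such an \<open>H\<close> to give one
  vertex of \<open>X\<close> a neighbourhood of its own.\<close>

definition edge :: "'a \<Rightarrow> 'a \<Rightarrow> bool" where
  "edge u v \<longleftrightarrow> u \<in> X \<and> v \<in> Y \<and> H u v \<or> v \<in> X \<and> u \<in> Y \<and> H v u"

lemma edge_sym: "edge u v \<Longrightarrow> edge v u"
  by (auto simp: edge_def)

lemma edge_XY: "x \<in> X \<Longrightarrow> edge x y \<longleftrightarrow> y \<in> Y \<and> H x y"
  using disjoint by (auto simp: edge_def)

definition nbrs :: "'a \<Rightarrow> 'a set" where
  "nbrs x = {y \<in> Y. H x y}"

lemma finite_nbrs [simp]: "finite (nbrs x)"
  by (simp add: nbrs_def finite_Y)

text \<open>The set \<open>S\<close> records the part of \<open>X\<close> already covered: it grows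
  by one vertex at a time, while the vertices used in \<open>Y\<close> may change.\<close>

definition alt :: "'a set \<Rightarrow> 'a list \<Rightarrow> bool" where
  "alt S L \<longleftrightarrow> cycle edge L \<and> set L \<subseteq> X \<union> Y \<and> set L \<inter> X = S \<and> card (set L \<inter> Y) = card S"

lemma alt_length:
  assumes "alt S L"
  shows "length L = 2 * card S"
proof -
  have "card (set L) = card (set L \<inter> X) + card (set L \<inter> Y)"
    using assms disjoint by (subst card_Un_disjoint[symmetric]) (auto simp: alt_def intro!: arg_cong[of _ _ card])
  moreover have "length L = card (set L)"
    using assms by (simp add: alt_def cycle_def distinct_card)
  ultimately show ?thesis using assms by (simp add: alt_def)
qed

lemma alt_start_at:
  assumes "alt S L" and "v \<in> set L"
  obtains M where "alt S (v # M)" and "set (v # M) = set L"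
  using assms unfolding alt_def by (metis cycle_start_at)

lemma alt_append_commute:
  assumes "alt S (xs @ ys)"
  shows "alt S (ys @ xs)"
proof -
  have "set (ys @ xs) = set (xs @ ys)" by auto
  then show ?thesis using assms cycle_append_commute unfolding alt_def by metis
qed

section \<open>Enlarging an alternating cycle by one vertex of \<open>X\<close>\<close>

lemma extend_at_end:
  assumes L: "alt S L" and x0: "x0 \<in> X" "x0 \<notin> S" and y: "y \<in> nbrs x0" "y \<in> nbrs (hd L)" "y \<notin> set L"
    and last: "last L \<in> nbrs x0" and hd: "hd L \<in> X"
  shows "alt (insert x0 S) (L @ [x0, y])"
proof -
  have fin: "finite S" "finite (set L \<inter> Y)" using L by (auto simp: alt_def)
  have x0L: "x0 \<notin> set L" using L x0 by (auto simp: alt_def)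
  have ne: "L \<noteq> []" using L by (auto simp: alt_def cycle_def)
  have yY: "y \<in> Y" using y by (auto simp: nbrs_def)
  have "x0 \<noteq> y" using x0 yY disjoint by auto
  moreover have "edge (last L) x0" "edge x0 y" "edge y (hd L)"
    using x0 y last hd by (auto simp: edge_def nbrs_def)
  ultimately have "cycle edge (L @ [x0, y])"
    using L x0L y ne by (auto simp: alt_def cycle_def successively_append_iff)
  moreover have "set (L @ [x0, y]) \<inter> Y = insert y (set L \<inter> Y)"
    using x0 yY disjoint by auto
  moreover have "set (L @ [x0, y]) \<inter> X = insert x0 (set L \<inter> X)"
    using x0 yY disjoint by auto
  ultimately show ?thesis using L fin x0 y yY by (auto simp: alt_def)
qed

text \<open>Two arcs both end at neighbours of \<open>x0\<close> and both begin at neighbours of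
  \<open>y\<close>. Reversing the second arc brings its end next to \<open>x0\<close> and its
  beginning next to \<open>y\<close>.\<close>

lemma extend_crossing:
  assumes L: "alt S (us @ vs)" and ne: "us \<noteq> []" "vs \<noteq> []" and x0: "x0 \<in> X" "x0 \<notin> S"
    and y: "y \<in> nbrs (hd us)" "y \<in> nbrs (hd vs)" "y \<notin> set (us @ vs)"
    and hd: "hd us \<in> X" "hd vs \<in> X" and last: "last us \<in> nbrs x0" "last vs \<in> nbrs x0"
  shows "alt (insert x0 S) (us @ [x0] @ rev vs @ [y])"
proof -
  let ?L' = "us @ [x0] @ rev vs @ [y]"
  have fin: "finite S" using L by (auto simp: alt_def)
  have x0L: "x0 \<notin> set (us @ vs)" using L x0 by (auto simp: alt_def)
  have yY: "y \<in> Y" using y by (auto simp: nbrs_def)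
  have "x0 \<noteq> y" using x0 yY disjoint by auto
  moreover have "edge (last us) x0" "edge x0 (last vs)" "edge (hd vs) y" "edge y (hd us)"
    using x0 y last hd by (auto simp: edge_def nbrs_def)
  moreover have distinct: "distinct (us @ vs)" and "successively edge us"
    using L by (simp_all add: alt_def cycle_def successively_append_iff)
  moreover have "successively edge (rev vs)"
  proof -
    have "successively edge vs" using L ne by (auto simp: alt_def cycle_def successively_append_iff)
    then show ?thesis by (auto simp: successively_rev intro: edge_sym elim: successively_mono)
  qed
  moreover have "distinct ?L'"
    using distinct x0L y(3) \<open>x0 \<noteq> y\<close> by auto
  ultimately have "cycle edge ?L'"
    using ne by (simp add: cycle_def successively_append_iff successively_Cons hd_append hd_rev last_rev del: successively_rev)
  moreover have "set ?L' \<inter> Y = insert y (set (us @ vs) \<inter> Y)"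
    using x0 yY disjoint by auto
  moreover have "set ?L' \<inter> X = insert x0 (set (us @ vs) \<inter> X)"
    using x0 yY disjoint by auto
  ultimately show ?thesis using L fin x0 y yY by (auto simp: alt_def)
qed

lemma extend_between:
  assumes L: "alt S (a # y # b # M)" and ab: "a \<in> X" "b \<in> X" and x0: "x0 \<in> X" "x0 \<notin> S"
    and y1: "y1 \<in> nbrs a" "y1 \<in> nbrs x0" "y1 \<notin> set (a # y # b # M)"
    and y2: "y2 \<in> nbrs b" "y2 \<in> nbrs x0" "y2 \<notin> set (a # y # b # M)" and "y1 \<noteq> y2"
  shows "alt (insert x0 S) (a # y1 # x0 # y2 # b # M)"
proof -
  let ?L = "a # y # b # M" and ?L' = "a # y1 # x0 # y2 # b # M"
  have fin: "finite S" using L by (auto simp: alt_def)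
  have x0L: "x0 \<notin> set ?L" using L x0 by (auto simp: alt_def)
  have yY: "y1 \<in> Y" "y2 \<in> Y" using y1 y2 by (auto simp: nbrs_def)
  have y: "y \<in> Y" using L ab disjoint by (auto simp: alt_def cycle_def edge_def)
  have "x0 \<noteq> y1" "x0 \<noteq> y2" using x0 yY disjoint by auto
  moreover have "edge a y1" "edge y1 x0" "edge x0 y2" "edge y2 b"
    using x0 y1 y2 ab by (auto simp: edge_def nbrs_def)
  ultimately have "cycle edge ?L'"
    using L x0L y1 y2 \<open>y1 \<noteq> y2\<close> by (auto simp: alt_def cycle_def successively_append_iff split: if_splits)
  moreover have "set ?L' \<inter> Y = insert y1 (insert y2 (set ?L \<inter> Y - {y}))"
    using x0 yY disjoint L ab y by (auto simp: alt_def cycle_def)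
  moreover have "set ?L' \<inter> X = insert x0 (set ?L \<inter> X)"
    using x0 yY y disjoint by auto
  moreover have "card (insert y1 (insert y2 (set ?L \<inter> Y - {y}))) = Suc (card (set ?L \<inter> Y))"
  proof -
    have "y \<in> set ?L \<inter> Y" using y by auto
    then have "Suc (card (set ?L \<inter> Y - {y})) = card (set ?L \<inter> Y)"
      by (metis List.finite_set card_Suc_Diff1 finite_Int)
    then show ?thesis using y1 y2 \<open>y1 \<noteq> y2\<close> by auto
  qed
  ultimately show ?thesis using L fin x0 yY unfolding alt_def by simp
qed

text \<open>If \<open>x\<^sub>0\<close> cannot be added to the cycle, then \<open>x\<^sub>0\<close> and the successors of its neighbours on the
  cycle have pairwise disjoint sets of neighbours outside the cycle.\<close>

lemma not_extendable_card:
  assumes L: "alt S L" and x0: "x0 \<in> X" "x0 \<notin> S" and nex: "\<nexists>L'. alt (insert x0 S) L'"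
  defines "I \<equiv> {i. i < length L \<and> L ! i \<in> nbrs x0}"
  shows "card (nbrs x0 - set L) + (\<Sum>i\<in>I. card (nbrs (L ! (Suc i mod length L)) - set L))
           \<le> card (Y - set L)"
proof -
  let ?s = "\<lambda>i. L ! (Suc i mod length L)"
  let ?O = "\<lambda>v. nbrs v - set L"
  have ne: "L \<noteq> []" and cyc: "cycle edge L" using L by (auto simp: alt_def cycle_def)
  have finI: "finite I" by (simp add: I_def)
  have LI: "L ! i \<in> Y" "i < length L" if "i \<in> I" for i using that by (auto simp: I_def nbrs_def)
  have sX: "?s i \<in> X" if "i \<in> I" for i
    using cycle_nth[OF cyc] LI[OF that] disjoint by (fastforce simp: edge_def)
  have set_rot: "set (drop k L @ take k L) = set L" for k
    by (metis append_take_drop_id set_append sup_commute)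
  have rot: "alt S (drop k L @ take k L)" for k
    by (rule alt_append_commute) (simp add: L)
  have hdrot: "hd (drop (Suc i) L @ take (Suc i) L) = ?s i" if "i < length L" for i
  proof (cases "Suc i < length L")
    case True then show ?thesis by (simp add: hd_append hd_drop_conv_nth)
  next
    case False
    then have "Suc i = length L" using that by simp
    then show ?thesis using ne by (simp add: hd_conv_nth)
  qed
  have lasttake: "last (take (Suc i) L) = L ! i" if "i < length L" for i
    using that by (simp add: take_Suc_conv_app_nth)
  have D0: "?O x0 \<inter> ?O (?s i) = {}" if i: "i \<in> I" for i
  proof (rule ccontr)
    assume "\<not> ?thesis"
    then obtain y where y: "y \<in> nbrs x0" "y \<in> nbrs (?s i)" "y \<notin> set L" by auto
    let ?L = "drop (Suc i) L @ take (Suc i) L"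
    have "set ?L = set L" by (rule set_rot)
    moreover have "last ?L = L ! i" using LI[OF i] lasttake ne by simp
    ultimately have "alt (insert x0 S) (?L @ [x0, y])"
      using extend_at_end[OF rot x0, of y "Suc i"] y hdrot LI[OF i] sX[OF i] i by (auto simp: I_def)
    then show False using nex by blast
  qed
  have D1: "?O (?s i) \<inter> ?O (?s j) = {}" if ij: "i \<in> I" "j \<in> I" "i < j" for i j
  proof (rule ccontr)
    assume "\<not> ?thesis"
    then obtain y where y: "y \<in> nbrs (?s j)" "y \<in> nbrs (?s i)" "y \<notin> set L" by auto
    \<comment> \<open>Cutting after the positions \<open>i\<close> and \<open>j\<close> leaves two
      arcs that end at neighbours of \<open>x0\<close> and begin at the cyclic successors of such
      neighbours. A common outside neighbour \<open>y\<close> of these successors fits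
      \<open>extend_crossing\<close>.\<close>
    define B where "B = drop (Suc i) (take (Suc j) L)"
    define us where "us = drop (Suc j) L @ take (Suc i) L"
    have jl: "j < length L" using LI ij by auto
    have "take (Suc j) L = take (Suc i) L @ B"
      unfolding B_def using ij by (metis Suc_le_mono append_take_drop_id less_imp_le_nat min.absorb1 take_take)
    then have rL: "drop (Suc j) L @ take (Suc j) L = us @ B" by (simp add: us_def)
    have B: "B \<noteq> []" "hd B = ?s i" "last B = L ! j"
      using ij jl by (auto simp: B_def hd_drop_conv_nth lasttake)
    have us: "us \<noteq> []" "hd us = ?s j" "last us = L ! i"
      using ij jl ne hdrot[of j] lasttake[of i]
      by (auto simp: us_def hd_append)
    have "set (us @ B) = set L"
      using set_rot[of "Suc j"] rL by simp
    then have "alt (insert x0 S) (us @ [x0] @ rev B @ [y])"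
      using rot[of "Suc j"] rL y us B sX[OF ij(1)] sX[OF ij(2)] ij x0
      by (intro extend_crossing) (simp_all add: I_def)
    then show False using nex by blast
  qed
  then have D: "\<forall>i\<in>I. \<forall>j\<in>I. i \<noteq> j \<longrightarrow> ?O (?s i) \<inter> ?O (?s j) = {}"
    by (metis Int_commute linorder_neqE_nat)
  have "card (?O x0 \<union> (\<Union>i\<in>I. ?O (?s i))) = card (?O x0) + card (\<Union>i\<in>I. ?O (?s i))"
    using D0 finI by (intro card_Un_disjoint) auto
  also have "card (\<Union>i\<in>I. ?O (?s i)) = (\<Sum>i\<in>I. card (?O (?s i)))"
    using D finI by (intro card_UN_disjoint) auto
  finally have "card (?O x0) + (\<Sum>i\<in>I. card (?O (?s i))) = card (?O x0 \<union> (\<Union>i\<in>I. ?O (?s i)))" ..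
  also have "\<dots> \<le> card (Y - set L)"
    by (intro card_mono) (auto simp: nbrs_def finite_Y)
  finally show ?thesis .
qed

lemma alt_take3:
  assumes "alt S L" and "card S \<ge> 2" and "hd L \<in> X"
  obtains a y b M where "L = a # y # b # M" and "a \<in> S" "b \<in> S" "a \<noteq> b" "y \<in> Y"
proof -
  have "length L \<ge> 4" using alt_length[OF assms(1)] assms(2) by simp
  then obtain a y b M where L: "L = a # y # b # M"
    by (cases L; cases "tl L"; cases "tl (tl L)") auto
  have "cycle edge (a # y # b # M)" using assms L by (simp add: alt_def)
  then show ?thesis using that[OF L] assms(1,3) L disjoint
    by (auto simp: alt_def cycle_def edge_def)
qed

text \<open>If \<open>Z\<close> is a singleton, then \<open>S\<close> has at least three elements:
  the cycle is started at the vertex of \<open>Z\<close>, and the next two vertices of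
  \<open>X\<close> along it avoid \<open>Z\<close>.\<close>

lemma alt_consecutive:
  assumes L: "alt S L" and Z: "Z \<subseteq> S" "card Z \<le> 1" and S: "card S \<ge> 2 + card Z"
  obtains a y b M where "alt S (a # y # b # M)" and "set (a # y # b # M) = set L"
    and "a \<in> S - Z" "b \<in> S - Z"
proof -
  have finS: "finite S" using L by (auto simp: alt_def)
  have SL: "S \<subseteq> set L" and SX: "S \<subseteq> X" using L by (auto simp: alt_def)
  have finZ: "finite Z" using finS Z by (meson finite_subset)
  have S2: "card S \<ge> 2" using S by simp
  show ?thesis
  proof (cases "Z = {}")
    case True
    from S obtain s where "s \<in> S" by fastforce
    then obtain M where M: "alt S (s # M)" "set (s # M) = set L"
      using alt_start_at[OF L] SL by blast
    have "hd (s # M) \<in> X" using SX \<open>s \<in> S\<close> by auto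
    from alt_take3[OF M(1) S2 this] obtain a y b N where "s # M = a # y # b # N" "a \<in> S" "b \<in> S" .
    then show ?thesis using that[of a y b N] M True by simp
  next
    case False
    then obtain s where s: "Z = {s}" using Z(2) finZ
      by (metis One_nat_def card_0_eq card_1_singletonE le_Suc_eq le_zero_eq)
    then have "s \<in> S" using Z by simp
    then obtain M where M: "alt S (s # M)" "set (s # M) = set L"
      using alt_start_at[OF L] SL by blast
    have "hd (s # M) \<in> X" using SX \<open>s \<in> S\<close> by auto
    from alt_take3[OF M(1) S2 this] obtain y0 a M' where M': "s # M = s # y0 # a # M'" "a \<in> S" "a \<noteq> s" "y0 \<in> Y"
      by (metis list.inject)
    have alt': "alt S ((a # M') @ [s, y0])"
      using alt_append_commute[of S "[s, y0]" "a # M'"] M(1) M'(1) by simp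
    have "hd ((a # M') @ [s, y0]) \<in> X" using M' SX by auto
    from alt_take3[OF alt' S2 this] obtain y b N where N: "(a # M') @ [s, y0] = a # y # b # N" "b \<in> S" "y \<in> Y"
      by (metis append_Cons list.inject)
    have "length M' = 2 * card S - 3" using alt_length[OF alt'] by simp
    then have "length M' \<ge> 2" using S s by simp
    then have "b \<in> set M'" using N(1) by (cases M'; cases "tl M'") auto
    moreover have "s \<notin> set M'" using alt' by (simp add: alt_def cycle_def)
    ultimately have "b \<noteq> s" by auto
    moreover have "set ((a # M') @ [s, y0]) = set L" using M(2) M'(1) by auto
    ultimately show ?thesis using that[of a y b N] alt' N(2) s M'(2,3) unfolding N(1) by simp
  qed
qed

text \<open>The set \<open>Z\<close> makes room for an artificial vertex of degree two, which turns a path with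
  prescribed ends into a cycle.\<close>

lemma alt_extend:
  assumes Z: "card Z \<le> 1" "Z \<subseteq> S"
    and deg: "\<And>x. x \<in> X - Z \<Longrightarrow> k \<le> card (nbrs x)"
    and cX: "card X \<le> k" and cY: "card Y + card Z + 2 \<le> 2 * k"
    and L: "alt S L" and S: "card S \<ge> 2 + card Z" and x0: "x0 \<in> X - S"
  shows "\<exists>L'. alt (insert x0 S) L'"
proof (rule ccontr)
  assume nex: "\<not> ?thesis"
  have SX: "S \<subseteq> X" and finS: "finite S" using L by (auto simp: alt_def)
  have finZ: "finite Z" using finS Z by (meson finite_subset)
  have x0Z: "x0 \<in> X - Z" using x0 Z by auto
  have mk: "card S < k"
    using psubset_card_mono[OF finite_X, of S] SX x0 cX by force
  define t where "t = card (nbrs x0 \<inter> set L)"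
  have out: "card (nbrs x - set L) = card (nbrs x) - card (nbrs x \<inter> set L)" for x
    using card_Diff_subset_Int[of "nbrs x" "set L"] by simp
  have inle: "card (nbrs x \<inter> set L) \<le> card (nbrs x)" for x by (simp add: card_mono)
  show False
  proof (cases "t \<le> card Z")
    case True
    obtain a y b M where M: "alt S (a # y # b # M)" "set (a # y # b # M) = set L"
      and ab: "a \<in> S - Z" "b \<in> S - Z"
      using alt_consecutive[OF L Z(2,1) S] by blast
    \<comment> \<open>Two subsets of \<open>Y\<close> of size at least \<open>k\<close> meet in at
      least \<open>2 * k - card Y\<close> elements, hence in at least \<open>card Z + 2\<close>; at
      most \<open>t <= card Z\<close> of these lie on the cycle.\<close>
    have two: "2 \<le> card (nbrs x \<inter> nbrs x0 - set L)" if "x \<in> S - Z" for x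
    proof -
      have "card (nbrs x \<union> nbrs x0) \<le> card Y"
        by (intro card_mono) (auto simp: nbrs_def finite_Y)
      moreover have "card (nbrs x \<union> nbrs x0) + card (nbrs x \<inter> nbrs x0) = card (nbrs x) + card (nbrs x0)"
        by (rule card_Un_Int[symmetric]) auto
      moreover have "k \<le> card (nbrs x)" "k \<le> card (nbrs x0)"
        using deg that SX x0Z by auto
      moreover have "card (nbrs x \<inter> nbrs x0) \<le> card (nbrs x \<inter> nbrs x0 - set L) + t"
      proof -
        have "card (nbrs x \<inter> nbrs x0) \<le> card ((nbrs x \<inter> nbrs x0 - set L) \<union> (nbrs x0 \<inter> set L))"
          by (intro card_mono) auto
        also have "\<dots> \<le> card (nbrs x \<inter> nbrs x0 - set L) + t"
          unfolding t_def by (rule card_Un_le)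
        finally show ?thesis .
      qed
      ultimately show ?thesis using True cY by linarith
    qed
    obtain y1 where y1: "y1 \<in> nbrs a \<inter> nbrs x0 - set L"
      using two[OF ab(1)] by (metis card.empty ex_in_conv not_numeral_le_zero)
    have "\<not> nbrs b \<inter> nbrs x0 - set L \<subseteq> {y1}"
      using two[OF ab(2)] card_mono[of "{y1}" "nbrs b \<inter> nbrs x0 - set L"] by auto
    then obtain y2 where y2: "y2 \<in> nbrs b \<inter> nbrs x0 - set L" "y2 \<noteq> y1" by auto
    have "alt (insert x0 S) (a # y1 # x0 # y2 # b # M)"
      using y1 y2 ab x0 SX M(2) by (intro extend_between[OF M(1)]) auto
    then show False using nex by blast
  next
    case False
    define I where "I = {i. i < length L \<and> L ! i \<in> nbrs x0}"
    let ?s = "\<lambda>i. L ! (Suc i mod length L)"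
    have cyc: "cycle edge L" and dist: "distinct L" and ne: "L \<noteq> []"
      using L by (auto simp: alt_def cycle_def)
    have finI: "finite I" by (simp add: I_def)
    have "bij_betw ((!) L) I (nbrs x0 \<inter> set L)"
      unfolding bij_betw_def
    proof
      show "inj_on ((!) L) I" using dist by (auto simp: inj_on_def I_def nth_eq_iff_index_eq)
      show "(!) L ` I = nbrs x0 \<inter> set L" by (auto simp: I_def in_set_conv_nth)
    qed
    then have cI: "card I = t" unfolding t_def by (rule bij_betw_same_card)
    have injs: "inj_on ?s I"
    proof (rule inj_onI)
      fix i j assume ij: "i \<in> I" "j \<in> I" "?s i = ?s j"
      then have "Suc i mod length L = Suc j mod length L"
        using dist ne by (simp add: nth_eq_iff_index_eq)
      moreover have "i < length L" "j < length L" using ij by (auto simp: I_def)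
      ultimately show "i = j" by (metis Suc_lessI diff_Suc_1 mod_less mod_self nat.distinct(1) old.nat.inject)
    qed
    \<comment> \<open>At most \<open>card Z\<close> successors are lost to \<open>Z\<close>, whose
      vertices carry no degree bound.\<close>
    define J where "J = {i\<in>I. ?s i \<notin> Z}"
    have "card (I - J) \<le> card Z"
      using finZ inj_on_subset[OF injs, of "I - J"]
      by (intro card_inj_on_le[of ?s]) (auto simp: J_def)
    moreover have "card (I - J) = card I - card J"
      using finI by (intro card_Diff_subset) (auto simp: J_def)
    ultimately have cJ: "t \<le> card J + card Z" using cI by linarith
    have sX: "?s i \<in> S" if "i \<in> I" for i
    proof -
      have "edge (L ! i) (?s i)" using cycle_nth[OF cyc] that by (auto simp: I_def)
      moreover have "L ! i \<in> Y" using that by (auto simp: I_def nbrs_def)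
      moreover have "?s i \<in> set L" using ne by simp
      ultimately show ?thesis using L disjoint by (auto simp: alt_def edge_def)
    qed
    have ge: "k - card S \<le> card (nbrs (?s i) - set L)" if "i \<in> J" for i
    proof -
      have "k \<le> card (nbrs (?s i))" using that sX SX by (intro deg) (auto simp: J_def)
      moreover have "card (nbrs (?s i) \<inter> set L) \<le> card (set L \<inter> Y)"
        by (intro card_mono) (auto simp: nbrs_def)
      moreover have "card (set L \<inter> Y) = card S" using L by (simp add: alt_def)
      ultimately show ?thesis unfolding out by linarith
    qed
    have "card J * (k - card S) \<le> (\<Sum>i\<in>J. card (nbrs (?s i) - set L))"
      using sum_mono[of J "\<lambda>_. k - card S", OF ge] by simp
    also have "\<dots> \<le> (\<Sum>i\<in>I. card (nbrs (?s i) - set L))"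
      using finI by (intro sum_mono2) (auto simp: J_def)
    finally have 1: "card J * (k - card S) \<le> (\<Sum>i\<in>I. card (nbrs (?s i) - set L))" .
    have 2: "card (nbrs x0 - set L) + (\<Sum>i\<in>I. card (nbrs (?s i) - set L)) \<le> card (Y - set L)"
      using not_extendable_card[OF L _ _ nex] x0 unfolding I_def by blast
    have 3: "k \<le> card (nbrs x0 - set L) + t"
      using deg[OF x0Z] inle[of x0] unfolding out t_def by linarith
    have 4: "card (Y - set L) = card Y - card S"
      using L finite_Y card_Diff_subset_Int[of Y "set L"] by (simp add: alt_def Int_commute)
    have "card S \<le> card Y"
      using L finite_Y by (metis Int_lower2 alt_def card_mono)
    \<comment> \<open>With \<open>card J = e + 1\<close> and \<open>k - card S = d + 1\<close> the
      product is at least \<open>card J + d\<close>. Together with the facts 1 to 4 this forces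
      \<open>2 * k <= card Y + card Z + 1\<close>.\<close>
    define d where "d = k - card S - 1"
    have d: "k - card S = Suc d" using mk by (simp add: d_def)
    obtain e where e: "card J = Suc e" using False cJ by (cases "card J") auto
    have "card J * (k - card S) = card J + d + e * d" unfolding d e by simp
    then show False using 1 2 3 4 d cJ cY \<open>card S \<le> card Y\<close> by linarith
  qed
qed

lemma alternating_cycle:
  assumes Z: "card Z \<le> 1" "Z \<subseteq> S"
    and deg: "\<And>x. x \<in> X - Z \<Longrightarrow> k \<le> card (nbrs x)"
    and cX: "card X \<le> k" and cY: "card Y + card Z + 2 \<le> 2 * k"
    and L: "alt S L" and S: "card S \<ge> 2 + card Z"
  shows "\<exists>L. alt X L"
proof -
  have SX: "S \<subseteq> X" using L by (auto simp: alt_def)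
  have "\<exists>L. alt (S \<union> W) L" if "finite W" "W \<subseteq> X" for W
    using that
  proof (induction W)
    case empty
    then show ?case using L by auto
  next
    case (insert x W)
    then obtain L' where L': "alt (S \<union> W) L'" by auto
    show ?case
    proof (cases "x \<in> S")
      case True
      then show ?thesis using L' by (metis Un_iff Un_insert_right insert_absorb)
    next
      case False
      have "finite (S \<union> W)" using SX finite_X insert by (auto intro: finite_subset)
      then have "card S \<le> card (S \<union> W)" by (simp add: card_mono)
      then show ?thesis
        using alt_extend[of Z "S \<union> W" k L' x] Z deg cX cY L' S False insert by auto
    qed
  qed
  from this[of X] show ?thesis using finite_X SX by (simp add: Un_absorb1)
qed

text \<open>This is Jackson's theorem. The degree bound gives any two vertices of \<open>X\<close>
  at least \<open>2 * k - card Y >= 2\<close> common neighbours, so there is a four-cycle to start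
  from.\<close>

lemma alternating_cycle':
  assumes deg: "\<And>x. x \<in> X \<Longrightarrow> k \<le> card (nbrs x)"
    and cX: "2 \<le> card X" "card X \<le> k" and cY: "card Y + 2 \<le> 2 * k"
  shows "\<exists>L. alt X L"
proof -
  obtain a b where ab: "a \<in> X" "b \<in> X" "a \<noteq> b"
    using cX(1) by (metis card_le_Suc0_iff_eq finite_X not_less_eq_eq numeral_2_eq_2)
  have "card (nbrs a \<union> nbrs b) \<le> card Y"
    by (intro card_mono) (auto simp: nbrs_def finite_Y)
  moreover have "card (nbrs a \<union> nbrs b) + card (nbrs a \<inter> nbrs b) = card (nbrs a) + card (nbrs b)"
    by (rule card_Un_Int[symmetric]) auto
  ultimately have "2 \<le> card (nbrs a \<inter> nbrs b)" using deg[of a] deg[of b] ab cY by linarith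
  then obtain y1 y2 where y: "y1 \<in> nbrs a \<inter> nbrs b" "y2 \<in> nbrs a \<inter> nbrs b" "y1 \<noteq> y2"
    by (metis card_le_Suc0_iff_eq finite_Int finite_nbrs not_less_eq_eq numeral_2_eq_2)
  then have Y: "y1 \<in> Y" "y2 \<in> Y" by (auto simp: nbrs_def)
  have "set [a, y1, b, y2] \<inter> X = {a, b}" "set [a, y1, b, y2] \<inter> Y = {y1, y2}"
    using ab y Y disjoint by auto
  moreover have "cycle edge [a, y1, b, y2]"
    using ab y Y disjoint by (auto simp: cycle_def edge_def nbrs_def)
  ultimately have "alt {a, b} [a, y1, b, y2]"
    using ab y Y by (auto simp: alt_def)
  then show ?thesis
    using alternating_cycle[of "{}" "{a, b}" k] deg cX cY ab by auto
qed

end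

subsection \<open>Two-colourings and monochromatic stars\<close>

lemma successively_mono_on:
  assumes "successively P xs" and "\<And>u v. u \<in> set xs \<Longrightarrow> v \<in> set xs \<Longrightarrow> P u v \<Longrightarrow> Q u v"
  shows "successively Q xs"
  using assms by (auto simp: successively_conv_nth)

lemma successively_rev_sym:
  assumes "successively P xs" and "\<And>u v. P u v \<Longrightarrow> P v u"
  shows "successively P (rev xs)"
  using assms by (auto simp: successively_rev intro: successively_mono)

text \<open>The hypotheses are Hall's condition for choosing from two sets. \<open>B\<close> is
  taken from \<open>B0 - A0\<close> as far as possible, so that it uses little of
  \<open>A0\<close>.\<close>

lemma disjoint_subsets_of_card:
  assumes fin: "finite A0" "finite B0" and "n \<le> card A0" "m \<le> card B0" "n + m \<le> card (A0 \<union> B0)"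
  obtains A B where "A \<subseteq> A0" "B \<subseteq> B0" "card A = n" "card B = m" "A \<inter> B = {}"
proof -
  have un: "card (A0 \<union> B0) = card A0 + card (B0 - A0)"
    using card_Un_disjoint[of A0 "B0 - A0"] fin by simp
  show ?thesis
  proof (cases "m \<le> card (B0 - A0)")
    case True
    then obtain B where "B \<subseteq> B0 - A0" "card B = m" by (meson obtain_subset_with_card_n)
    moreover obtain A where "A \<subseteq> A0" "card A = n" using assms by (meson obtain_subset_with_card_n)
    ultimately show ?thesis using that[of A B] by blast
  next
    case False
    have "card B0 = card (B0 - A0) + card (A0 \<inter> B0)"
      using card_Diff_subset_Int[of B0 A0] fin card_mono[of B0 "B0 \<inter> A0"] by (simp add: Int_commute)
    then have "m - card (B0 - A0) \<le> card (A0 \<inter> B0)" using assms by linarith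
    then obtain B1 where B1: "B1 \<subseteq> A0 \<inter> B0" "card B1 = m - card (B0 - A0)"
      by (meson obtain_subset_with_card_n)
    have fB1: "finite B1" using B1 fin by (auto intro: finite_subset)
    have "card (A0 - B1) = card A0 - card B1" using B1 fB1 by (intro card_Diff_subset) auto
    then have "n \<le> card (A0 - B1)" using un assms B1 False by linarith
    then obtain A where A: "A \<subseteq> A0 - B1" "card A = n" by (meson obtain_subset_with_card_n)
    have "card (B0 - A0 \<union> B1) = m"
      using card_Un_disjoint[of "B0 - A0" B1] fin fB1 B1 False by auto
    then show ?thesis using that[of A "B0 - A0 \<union> B1"] A B1 by blast
  qed
qed

locale two_colouring =
  fixes V :: "'a set" and f :: "'a set \<Rightarrow> bool"
  assumes finite_V: "finite V"
begin

text \<open>Colours are truth values, so that the other colour is \<open>\<not> c\<close> and every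
  lemma serves both colours.\<close>

definition col :: "bool \<Rightarrow> 'a \<Rightarrow> 'a \<Rightarrow> bool" where
  "col c u v \<longleftrightarrow> u \<in> V \<and> v \<in> V \<and> u \<noteq> v \<and> f {u, v} = c"

definition nb :: "bool \<Rightarrow> 'a \<Rightarrow> 'a set \<Rightarrow> 'a set" where
  "nb c v U = {w \<in> U. col c v w}"

text \<open>This is a monochromatic copy of \<open>linked_double_star l n m\<close>, with the
  embedding split into the linking path and the two sets of leaves.\<close>

definition has_star :: "bool \<Rightarrow> nat \<Rightarrow> nat \<Rightarrow> nat \<Rightarrow> bool" where
  "has_star c l n m \<longleftrightarrow> (\<exists>P A B. P \<noteq> [] \<and> length P = l \<and> distinct P \<and> successively (col c) P \<and>
     card A = n \<and> card B = m \<and> A \<inter> B = {} \<and> (A \<union> B) \<inter> set P = {} \<and>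
     (\<forall>a\<in>A. col c (hd P) a) \<and> (\<forall>b\<in>B. col c (last P) b))"

lemma col_sym: "col c u v \<Longrightarrow> col c v u"
  by (auto simp: col_def insert_commute)

lemma col_irrefl [simp]: "\<not> col c u u"
  by (simp add: col_def)

lemma col_V: "col c u v \<Longrightarrow> u \<in> V" "col c u v \<Longrightarrow> v \<in> V"
  by (auto simp: col_def)

lemma not_col: "u \<in> V \<Longrightarrow> v \<in> V \<Longrightarrow> u \<noteq> v \<Longrightarrow> \<not> col c u v \<longleftrightarrow> col (\<not> c) u v"
  by (auto simp: col_def)

lemma nb_subset: "nb c v U \<subseteq> U"
  by (auto simp: nb_def)

lemma finite_nb [simp]: "finite (nb c v U)"
  by (rule finite_subset[OF _ finite_V]) (auto simp: nb_def col_def)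

lemma card_nb_add:
  assumes "v \<in> V" "U \<subseteq> V" "v \<notin> U"
  shows "card (nb c v U) + card (nb (\<not> c) v U) = card U"
proof -
  have "nb c v U \<union> nb (\<not> c) v U = U" "nb c v U \<inter> nb (\<not> c) v U = {}"
    using assms by (auto simp: nb_def col_def)
  then show ?thesis using card_Un_disjoint[of "nb c v U" "nb (\<not> c) v U"] by simp
qed

lemma sum_card_nb:
  assumes "finite F" "finite R"
  shows "(\<Sum>r\<in>R. card (nb c r F)) = (\<Sum>x\<in>F. card (nb c x R))"
proof -
  have "(\<Sum>r\<in>R. card (nb c r F)) = (\<Sum>r\<in>R. \<Sum>x\<in>F. if col c r x then 1 else 0)"
    using assms by (simp add: nb_def sum.If_cases Int_def)
  also have "\<dots> = (\<Sum>x\<in>F. \<Sum>r\<in>R. if col c x r then 1 else 0)"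
    using col_sym by (subst sum.swap) (intro sum.cong refl, metis)
  also have "\<dots> = (\<Sum>x\<in>F. card (nb c x R))"
    using assms by (simp add: nb_def sum.If_cases Int_def)
  finally show ?thesis .
qed

text \<open>The candidate leaves at the two ends often overlap, so only a bound on their union is
  asked for; \<open>disjoint_subsets_of_card\<close> separates them.\<close>

lemma has_starI:
  assumes P: "P \<noteq> []" "length P = l" "distinct P" "successively (col c) P"
    and D: "D \<inter> set P = {}" "\<And>a. a \<in> D \<Longrightarrow> col c (hd P) a" "n \<le> card D"
    and E: "E \<inter> set P = {}" "\<And>b. b \<in> E \<Longrightarrow> col c (last P) b" "m \<le> card E"
    and AB: "n + m \<le> card (D \<union> E)"
  shows "has_star c l n m"
proof -
  have "D \<subseteq> V" "E \<subseteq> V" using D E by (auto simp: col_def)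
  then have "finite D" "finite E" using finite_V by (auto intro: finite_subset)
  then obtain D' E' where "D' \<subseteq> D" "E' \<subseteq> E" "card D' = n" "card E' = m" "D' \<inter> E' = {}"
    using disjoint_subsets_of_card D E AB by metis
  moreover from this have "(D' \<union> E') \<inter> set P = {}" using D(1) E(1) by blast
  ultimately show ?thesis
    unfolding has_star_def using P D E by (intro exI[of _ P] exI[of _ D'] exI[of _ E']) auto
qed

lemma cycle_subset_V:
  assumes "cycle (col c) C"
  shows "set C \<subseteq> V"
proof
  fix v assume "v \<in> set C"
  then obtain i where "i < length C" "v = C ! i" by (auto simp: in_set_conv_nth)
  then show "v \<in> V" using cycle_nth[OF assms] col_V by blast
qed

lemma alternating_cycle:
  assumes XY: "X \<subseteq> V" "Y \<subseteq> V" "X \<inter> Y = {}"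
    and deg: "\<And>x. x \<in> X \<Longrightarrow> k \<le> card (nb c x Y)"
    and cX: "2 \<le> card X" "card X \<le> k" and cY: "card Y + 2 \<le> 2 * k"
  obtains L where "cycle (\<lambda>u v. col c u v \<and> (u \<in> X \<longleftrightarrow> v \<in> Y)) L" "length L = 2 * card X"
    "set L \<subseteq> X \<union> Y" "X \<subseteq> set L"
proof -
  interpret bipartite "col c" X Y
    using XY finite_V by unfold_locales (auto intro: finite_subset)
  have "nbrs x = nb c x Y" for x by (auto simp: nbrs_def nb_def)
  then obtain L where L: "alt X L"
    using alternating_cycle'[of k] deg cX cY by metis
  have "cycle (\<lambda>u v. col c u v \<and> (u \<in> X \<longleftrightarrow> v \<in> Y)) L"
    using L XY unfolding alt_def
    by (elim conjE, elim cycle_mono) (auto simp: edge_def col_sym)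
  then show ?thesis
    using that[of L] L alt_length[OF L] by (auto simp: alt_def)
qed

lemma mono_cycle:
  assumes "X \<subseteq> V" "Y \<subseteq> V" "X \<inter> Y = {}"
    and "\<And>x. x \<in> X \<Longrightarrow> k \<le> card (nb c x Y)"
    and "2 \<le> card X" "card X \<le> k" and "card Y + 2 \<le> 2 * k"
  shows "\<exists>L. cycle (col c) L \<and> length L = 2 * card X"
proof -
  obtain L where "cycle (\<lambda>u v. col c u v \<and> (u \<in> X \<longleftrightarrow> v \<in> Y)) L" "length L = 2 * card X"
    by (rule alternating_cycle[OF assms])
  then show ?thesis using cycle_mono[of _ L "col c"] by blast
qed

text \<open>Double counting gives a vertex \<open>r0\<close> of \<open>R\<close> with many
  neighbours in \<open>F\<close> and another one, \<open>r1\<close>, with at least three. An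
  alternating path from \<open>r0\<close> to \<open>r1\<close> through \<open>q - 1\<close> vertices
  of \<open>F\<close> leaves enough of \<open>F\<close> for the leaves.\<close>

lemma star_in_dense_bipartite:
  assumes FR: "F \<subseteq> V" "R \<subseteq> V" "F \<inter> R = {}"
    and cR: "card R = n + q" and cF: "n + q + 1 \<le> card F"
    and deg: "\<And>x. x \<in> F \<Longrightarrow> q \<le> card (nb c x R)"
    and n: "2 \<le> n" "n + 3 \<le> q"
  shows "has_star c (2 * q - 1) n 2"
proof -
  have fin: "finite F" "finite R" using FR finite_V by (auto intro: finite_subset)
  have sum_ge: "q * card F \<le> (\<Sum>r\<in>R. card (nb c r F))"
    unfolding sum_card_nb[OF fin] using sum_mono[of F "\<lambda>_. q", OF deg] by (simp add: mult.commute)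
  have "\<exists>r0\<in>R. q + 1 \<le> card (nb c r0 F)"
  proof (rule ccontr)
    assume "\<not> ?thesis"
    then have "card (nb c r F) \<le> q" if "r \<in> R" for r using that by fastforce
    then have "(\<Sum>r\<in>R. card (nb c r F)) \<le> card R * q"
      using sum_bounded_above[of R "\<lambda>r. card (nb c r F)" q] by simp
    moreover have "card R * q < q * card F" using cR cF n by (simp add: mult.commute)
    ultimately show False using sum_ge by linarith
  qed
  then obtain r0 where r0: "r0 \<in> R" "q + 1 \<le> card (nb c r0 F)" by blast
  \<comment> \<open>Otherwise \<open>q * card F <= card F + 2 * (n + q)\<close>, which is impossible
    since \<open>q >= 5\<close> and \<open>card F > n + q\<close>.\<close>
  have "\<exists>r1\<in>R - {r0}. 3 \<le> card (nb c r1 F)"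
  proof (rule ccontr)
    assume "\<not> ?thesis"
    then have "card (nb c r F) < 3" if "r \<in> R - {r0}" for r using that not_le by blast
    then have "card (nb c r F) \<le> 2" if "r \<in> R - {r0}" for r using that by fastforce
    then have "(\<Sum>r\<in>R - {r0}. card (nb c r F)) \<le> card (R - {r0}) * 2"
      using sum_bounded_above[of "R - {r0}" "\<lambda>r. card (nb c r F)" 2] by simp
    moreover have "card (R - {r0}) \<le> card R" using fin by (simp add: card_Diff1_le)
    moreover have "card (nb c r0 F) \<le> card F" using fin by (intro card_mono nb_subset)
    moreover have "(\<Sum>r\<in>R. card (nb c r F)) = card (nb c r0 F) + (\<Sum>r\<in>R - {r0}. card (nb c r F))"
      using fin r0 by (simp add: sum.remove)
    ultimately have "q * card F \<le> card F + (n + q) + (n + q)"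
      using sum_ge cR unfolding mult_2 mult_2_right by linarith
    moreover have "5 * card F \<le> q * card F" using n by simp
    ultimately have "5 * card F \<le> card F + (n + q) + (n + q)" by (rule le_trans[rotated])
    then show False using cF n by linarith
  qed
  then obtain r1 where r1: "r1 \<in> R" "r1 \<noteq> r0" "3 \<le> card (nb c r1 F)" by blast
  \<comment> \<open>\<open>T\<close> supplies the leaves \<open>w1\<close>, \<open>w2\<close> of
    \<open>r1\<close> and a neighbour \<open>x2\<close> of \<open>r1\<close> for the starting cycle;
    below, \<open>A1\<close> supplies \<open>n\<close> leaves of \<open>r0\<close> and a neighbour
    \<open>x1\<close> of \<open>r0\<close>. This is possible since
    \<open>q + 1 - 3 >= n + 1\<close>.\<close>
  obtain T where T: "T \<subseteq> nb c r1 F" "card T = 3" using r1(3) by (meson obtain_subset_with_card_n)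
  then obtain w1 w2 x2 where T': "T = {w1, w2, x2}" "w1 \<noteq> w2" "w1 \<noteq> x2" "w2 \<noteq> x2"
    by (metis card_3_iff)
  have "card (nb c r0 F - T) = card (nb c r0 F) - card (nb c r0 F \<inter> T)"
    by (rule card_Diff_subset_Int) simp
  moreover have "card (nb c r0 F \<inter> T) \<le> 3" using T T'(1) card_mono[of T "nb c r0 F \<inter> T"] by simp
  ultimately have "n + 1 \<le> card (nb c r0 F - T)" using r0(2) n by linarith
  then obtain A1 where A1: "A1 \<subseteq> nb c r0 F - T" "card A1 = n + 1" by (meson obtain_subset_with_card_n)
  then obtain x1 where x1: "x1 \<in> A1" by fastforce
  have finA1: "finite A1" using A1 by (metis card.infinite add_is_0 one_neq_zero)
  define A where "A = A1 - {x1}"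
  have cA: "card A = n" using A1 x1 finA1 by (simp add: A_def)
  \<comment> \<open>\<open>W\<close> avoids all leaves. The bound \<open>n + q + 1 <= card F\<close>
    leaves at least \<open>q - 1\<close> vertices in it for the path.\<close>
  define W where "W = F - A - {w1, w2}"
  have AF: "A1 \<subseteq> F" and TF: "T \<subseteq> F" using A1 T nb_subset by blast+
  have "card W = card F - card (A \<union> {w1, w2})"
  proof -
    have "W = F - (A \<union> {w1, w2})" by (auto simp: W_def)
    then show ?thesis using finA1 AF TF T'(1) by (auto simp: A_def intro!: card_Diff_subset)
  qed
  moreover have "card (A \<union> {w1, w2}) = n + 2"
    using cA A1 T' finA1 by (subst card_Un_disjoint) (auto simp: A_def)
  ultimately have cW: "q - 1 \<le> card W" using cF by linarith
  have x12W: "{x1, x2} \<subseteq> W" using x1 A1 AF TF T' by (auto simp: W_def A_def)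
  have x12: "x1 \<noteq> x2" using x1 A1 T' by auto
  then have "card {x1, x2} \<le> q - 1" using n by simp
  moreover have "finite W" using fin by (simp add: W_def)
  ultimately obtain Z where Z: "{x1, x2} \<subseteq> Z" "Z \<subseteq> W" "card Z = q - 1"
    using exists_subset_between[OF _ cW x12W] by metis
  \<comment> \<open>The spare vertex \<open>w1\<close> serves as the artificial vertex, joined to \<open>r0\<close> and \<open>r1\<close> only.\<close>
  define H where "H u y \<longleftrightarrow> (if u = w1 then y = r0 \<or> y = r1 else col c u y)" for u y
  have w1: "w1 \<in> F" "w1 \<notin> Z" using TF T' Z by (auto simp: W_def)
  have ZF: "Z \<subseteq> F" using Z by (auto simp: W_def)
  have finZ: "finite Z" using ZF fin by (auto intro: finite_subset)
  interpret bipartite H "insert w1 Z" R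
    using FR fin ZF w1 by unfold_locales (auto intro: finite_subset)
  have nbrs_eq: "nbrs x = nb c x R" if "x \<noteq> w1" for x using that by (auto simp: nbrs_def nb_def H_def)
  \<comment> \<open>Since \<open>2 * q - (n + q) >= 3\<close>, some common neighbour of
    \<open>x1\<close> and \<open>x2\<close> differs from \<open>r0\<close> and \<open>r1\<close> and
    completes the starting cycle of length six.\<close>
  have "3 \<le> card (nb c x1 R \<inter> nb c x2 R)"
  proof -
    have "card (nb c x1 R \<union> nb c x2 R) \<le> card R"
      using fin by (intro card_mono) (auto simp: nb_def)
    moreover have "card (nb c x1 R \<union> nb c x2 R) + card (nb c x1 R \<inter> nb c x2 R)
        = card (nb c x1 R) + card (nb c x2 R)"
      by (rule card_Un_Int[symmetric]) auto
    moreover have "q \<le> card (nb c x1 R)" "q \<le> card (nb c x2 R)" using deg Z(1) ZF by auto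
    ultimately show ?thesis using cR n by linarith
  qed
  then have "\<not> nb c x1 R \<inter> nb c x2 R \<subseteq> {r0, r1}"
    using card_mono[of "{r0, r1}" "nb c x1 R \<inter> nb c x2 R"] card_insert_le_m1[of 2 "{r1}" r0] by auto
  then obtain y where y: "y \<in> nb c x1 R \<inter> nb c x2 R" "y \<noteq> r0" "y \<noteq> r1" by auto
  have S: "alt {w1, x1, x2} [w1, r0, x1, y, x2, r1]"
  proof -
    have "col c x1 r0" "col c x2 r1" using x1 A1 T T' by (auto simp: nb_def col_sym)
    moreover have xF: "x1 \<in> Z" "x2 \<in> Z" "x1 \<noteq> w1" "x2 \<noteq> w1" using Z w1 by auto
    moreover have yR: "y \<in> R" using y by (auto simp: nb_def)
    ultimately have e: "edge w1 r0" "edge x1 r0" "edge x1 y" "edge x2 y" "edge x2 r1" "edge w1 r1"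
      using r0 r1 y by (simp_all add: edge_XY H_def nb_def)
    have "distinct [w1, r0, x1, y, x2, r1]"
      using xF yR x12 r0 r1 y w1(1) FR ZF by auto
    then have "cycle edge [w1, r0, x1, y, x2, r1]"
      using e by (simp add: cycle_def edge_sym)
    moreover have "set [w1, r0, x1, y, x2, r1] \<inter> insert w1 Z = {w1, x1, x2}"
      using xF r0 r1 yR w1 FR ZF by auto
    moreover have "set [w1, r0, x1, y, x2, r1] \<inter> R = {r0, y, r1}"
      using xF r0 r1 yR w1 FR ZF by auto
    ultimately show ?thesis using xF r0 r1 yR y x12 by (auto simp: alt_def)
  qed
  \<comment> \<open>The artificial vertex costs one in Jackson's bound:
    \<open>card R + 1 + 2 <= 2 * q\<close> is exactly \<open>n + 3 <= q\<close>.\<close>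
  have "\<exists>L. alt (insert w1 Z) L"
  proof (rule alternating_cycle[OF _ _ _ _ _ S])
    show "q \<le> card (nbrs x)" if "x \<in> insert w1 Z - {w1}" for x
      using that deg ZF by (auto simp: nbrs_eq)
    show "card (insert w1 Z) \<le> q" using Z w1 n finZ by (simp add: card_insert_if)
    show "2 + card {w1} \<le> card {w1, x1, x2}"
    proof -
      have "w1 \<noteq> x1" "w1 \<noteq> x2" using Z(1) w1 by auto
      then show ?thesis using x12 by simp
    qed
  qed (use cR n in auto)
  then obtain L0 where L0: "alt (insert w1 Z) L0" by blast
  then have "w1 \<in> set L0" by (auto simp: alt_def)
  then obtain M where M: "alt (insert w1 Z) (w1 # M)" using alt_start_at[OF L0] by blast
  have lenM: "length M = 2 * q - 1"
    using alt_length[OF M] Z w1 finZ n by simp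
  then have Mne: "M \<noteq> []" using n by auto
  have M': "distinct M" "w1 \<notin> set M" "successively edge M" "edge w1 (hd M)" "edge (last M) w1"
    "set M \<subseteq> insert w1 Z \<union> R"
    using M Mne by (auto simp: alt_def cycle_def successively_Cons)
  have pathM: "successively (col c) M"
    using M'(3) by (rule successively_mono_on) (use M'(2) col_sym in \<open>auto simp: edge_def H_def split: if_splits\<close>)
  have ends: "hd M \<in> {r0, r1}" "last M \<in> {r0, r1}"
    using M'(4,5) w1 FR by (auto simp: edge_def H_def)
  have "hd M \<noteq> last M"
  proof -
    have "M ! 0 \<noteq> M ! (length M - 1)"
      using M'(1) lenM n by (subst nth_eq_iff_index_eq) auto
    then show ?thesis using Mne by (simp add: hd_conv_nth last_conv_nth)
  qed
  \<comment> \<open>Removing the artificial vertex leaves a path between \<open>r0\<close> and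
    \<open>r1\<close>, which is reversed if it starts at \<open>r1\<close>.\<close>
  then obtain P where P: "hd P = r0" "last P = r1" "set P = set M" "distinct P" "length P = length M"
    "successively (col c) P" "P \<noteq> []"
  proof (cases "hd M = r0")
    case True
    then show ?thesis using that[of M] ends \<open>hd M \<noteq> last M\<close> M' pathM Mne by auto
  next
    case False
    then show ?thesis using that[of "rev M"] ends \<open>hd M \<noteq> last M\<close> M' Mne
        successively_rev_sym[OF pathM col_sym] by (auto simp: hd_rev last_rev simp del: successively_rev)
  qed
  show ?thesis
  proof (rule has_starI[OF P(7) _ P(4,6), where D = A and E = "{w1, w2}"])
    have "A \<inter> (Z \<union> R) = {}" "w2 \<notin> Z \<union> R"
      using AF Z FR TF T'(1) by (auto simp: W_def A_def)
    then show "A \<inter> set P = {}" "{w1, w2} \<inter> set P = {}"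
      using M'(2,6) P(3) A1 T' by (auto simp: A_def)
    have "A \<inter> {w1, w2} = {}" using A1 T' by (auto simp: A_def)
    then have "card (A \<union> {w1, w2}) = n + 2"
      using cA T' finA1 by (subst card_Un_disjoint) (auto simp: A_def)
    then show "n + 2 \<le> card (A \<union> {w1, w2})" by simp
    show "col c (hd P) a" if "a \<in> A" for a using that A1 P by (auto simp: A_def nb_def)
    show "col c (last P) b" if "b \<in> {w1, w2}" for b using that T T'(1) P by (auto simp: nb_def)
  qed (use lenM P cA T' in auto)
qed

subsection \<open>Monochromatic even cycles\<close>

text \<open>Every other vertex sees two of three fixed vertices in the same colour. There are three
  pairs and two colours, so two of at least seven other vertices agree.\<close>

lemma mono_4_cycle:
  assumes "10 \<le> card V"
  shows "\<exists>c L. cycle (col c) L \<and> length L = 4"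
proof -
  have "3 \<le> card V" using assms by simp
  then obtain T where T: "T \<subseteq> V" "card T = 3" by (meson obtain_subset_with_card_n)
  then obtain a b d where abd: "T = {a, b, d}" "a \<noteq> b" "a \<noteq> d" "b \<noteq> d" by (metis card_3_iff)
  have "card (V - T) = card V - 3" using T finite_V by (metis card_Diff_subset finite_subset)
  then have "7 \<le> card (V - T)" using assms by simp
  define g where "g y = (let p = f {a, y}; q = f {b, y}; r = f {d, y} in
      if p = q then ((a, b), p) else if p = r then ((a, d), p) else ((b, d), q))" for y
  have "g ` (V - T) \<subseteq> {(a, b), (a, d), (b, d)} \<times> UNIV" by (auto simp: g_def Let_def)
  then have "card (g ` (V - T)) \<le> card ({(a, b), (a, d), (b, d)} \<times> (UNIV :: bool set))"
    by (intro card_mono) auto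
  also have "\<dots> = 6" using abd by (simp add: card_cartesian_product)
  finally have "card (g ` (V - T)) < card (V - T)" using \<open>7 \<le> card (V - T)\<close> by simp
  then have "\<not> inj_on g (V - T)" by (rule pigeonhole)
  then obtain y z where yz: "y \<in> V - T" "z \<in> V - T" "y \<noteq> z" "g y = g z" by (auto simp: inj_on_def)
  obtain u v c where uvc: "g y = ((u, v), c)" by (metis surj_pair)
  have g: "u \<in> T \<and> v \<in> T \<and> u \<noteq> v \<and> f {u, w} = c \<and> f {v, w} = c" if "g w = ((u, v), c)" for w
    using that abd by (auto simp: g_def Let_def split: if_splits)
  have "cycle (col c) [u, y, v, z]"
    using g[of y] g[of z] uvc yz T by (auto simp: cycle_def col_def insert_commute)
  then show ?thesis by (intro exI[of _ c] exI[of _ "[u, y, v, z]"]) simp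
qed

section \<open>Lengthening a monochromatic cycle\<close>

lemma insert_consecutive:
  assumes L: "cycle (col c) L" "length L = m" and r: "r \<notin> set L" and i: "i < m"
    and col: "col c r (L ! i)" "col c r (rotate1 L ! i)"
    and ge2: "2 \<le> m"
  shows "\<exists>L. cycle (col c) L \<and> length L = Suc m"
proof -
  have "length (rotate i L) \<ge> 2" using L ge2 by simp
  then obtain a b M where D: "rotate i L = a # b # M" by (cases "rotate i L"; cases "tl (rotate i L)") auto
  have "rotate i L ! 0 = L ! i" "rotate i L ! 1 = rotate1 L ! i"
    using i L ge2 nth_rotate[of i L 1] by (simp_all add: nth_rotate)
  then have ab: "a = L ! i" "b = rotate1 L ! i" unfolding D by simp_all
  have cyc: "cycle (col c) (a # b # M)" using cycle_rotate[OF L(1), of i] D by simp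
  have "set (a # b # M) = set L" by (metis D set_rotate)
  then have "cycle (col c) (a # r # b # M)"
    using cyc col ab r col_sym by (auto simp: cycle_def)
  moreover have "length (a # r # b # M) = Suc m" using L arg_cong[OF D, of length] by simp
  ultimately show ?thesis by blast
qed

text \<open>\<open>r\<close> and \<open>s\<close> are inserted and \<open>x2\<close> is dropped, so
  the cycle grows by one vertex; in \<open>odd_cycle_extend_next\<close> it is \<open>x1\<close>
  that is dropped.\<close>

lemma odd_cycle_extend_last:
  assumes D: "cycle (col c) (x0 # x1 # x2 # x3 # M)" "M \<noteq> []"
    and r: "r \<notin> set (x0 # x1 # x2 # x3 # M)" "col c r x0" "col c r x3"
    and s: "s \<notin> set (x0 # x1 # x2 # x3 # M)" "col c s x1" "col c s (last M)" and "r \<noteq> s"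
  shows "cycle (col c) (x1 # x0 # r # x3 # M @ [s])"
  using assms by (auto simp: cycle_def successively_Cons successively_append_iff col_sym)

lemma odd_cycle_extend_next:
  assumes D: "cycle (col c) (x0 # x1 # x2 # x3 # x4 # M)"
    and r: "r \<notin> set (x0 # x1 # x2 # x3 # x4 # M)" "col c r x0" "col c r x3"
    and s: "s \<notin> set (x0 # x1 # x2 # x3 # x4 # M)" "col c s x2" "col c s x4" and "r \<noteq> s"
  shows "cycle (col c) (x0 # r # x3 # x2 # s # x4 # M)"
  using assms by (auto simp: cycle_def successively_Cons col_sym)

lemma odd_cycle_halves:
  assumes D: "cycle (col c) D" "length D = 2 * k - 1" "3 \<le> k" and V: "3 * k - 1 \<le> card V"
    and no1: "\<nexists>L. cycle (col c) L \<and> length L = 2 * k"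
    and no2: "\<nexists>L. cycle (col (\<not> c)) L \<and> length L = 2 * k"
  shows "\<exists>r j. r \<in> V - set D \<and> j \<le> k - 1 \<and>
    (\<forall>p<k - 1. (p < j \<longrightarrow> col c r (D ! (2 * p + 1))) \<and> (j \<le> p \<longrightarrow> col c r (D ! (2 * p + 2))))"
proof -
  have DV: "set D \<subseteq> V" using D cycle_subset_V by blast
  obtain x E where DE: "D = x # E" using D by (cases D) auto
  have distD: "distinct D" using D by (simp add: cycle_def)
  then have lenE: "length E = 2 * (k - 1)" and cE: "card (set E) = 2 * (k - 1)"
    using D DE by (auto simp: distinct_card)
  have "card (V - set D) = card V - (2 * k - 1)"
    using D DV distD by (simp add: card_Diff_subset distinct_card)
  then have "k \<le> card (V - set D)" using V D(3) by linarith
  then obtain X where X: "X \<subseteq> V - set D" "card X = k" by (meson obtain_subset_with_card_n)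
  have "\<exists>r\<in>X. \<not> k \<le> card (nb (\<not> c) r (set E))"
  proof (rule ccontr)
    assume "\<not> ?thesis"
    then have "\<exists>L. cycle (col (\<not> c)) L \<and> length L = 2 * card X"
      using X DV DE cE D(3) by (intro mono_cycle[of X "set E" k]) auto
    then show False using no2 X by simp
  qed
  then obtain r where r: "r \<in> V - set D" "card (nb (\<not> c) r (set E)) < k" using X by (auto simp: not_le)
  have "card (nb c r (set E)) + card (nb (\<not> c) r (set E)) = 2 * (k - 1)"
    using r DV DE cE by (subst card_nb_add) auto
  then have ge: "k - 1 \<le> card (nb c r (set E))" using r D(3) by linarith
  have "length (filter (col c r) E) = card (nb c r (set E))"
    using distD DE distinct_card[of "filter (col c r) E"] by (simp add: nb_def)
  moreover have "successively (\<lambda>u v. \<not> (col c r u \<and> col c r v)) E"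
    unfolding successively_conv_nth
  proof (intro allI impI notI)
    fix i assume i: "Suc i < length E" and "col c r (E ! i) \<and> col c r (E ! Suc i)"
    then have "col c r (D ! Suc i)" "col c r (rotate1 D ! Suc i)"
      using DE by (simp_all add: nth_append)
    then have "\<exists>L. cycle (col c) L \<and> length L = Suc (2 * k - 1)"
      using r i DE D(2,3) by (intro insert_consecutive[OF D(1,2), of r "Suc i"]) auto
    then show False using no1 D(3) by simp
  qed
  ultimately obtain j where "j \<le> k - 1"
    "\<forall>p<k - 1. (p < j \<longrightarrow> col c r (E ! (2 * p))) \<and> (j \<le> p \<longrightarrow> col c r (E ! (2 * p + 1)))"
    using independent_half_of_path[OF _ lenE, of "col c r"] ge by (metis le_antisym)
  then show ?thesis using r DE by (intro exI[of _ r] exI[of _ j]) auto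
qed

text \<open>The red neighbourhood on the cycle of a vertex provided by \<open>odd_cycle_halves\<close> alternates
  except for one gap of length three. If \<open>r\<close> has its gap at \<open>D ! 0\<close>, then some \<open>s\<close> has its gap two steps
  earlier; applying this twice is contradictory.\<close>

lemma odd_cycle_shift:
  assumes D: "cycle (col c) D" "length D = 2 * k - 1" "3 \<le> k" and V: "3 * k - 1 \<le> card V"
    and no1: "\<nexists>L. cycle (col c) L \<and> length L = 2 * k"
    and no2: "\<nexists>L. cycle (col (\<not> c)) L \<and> length L = 2 * k"
    and r: "r \<in> V - set D" "col c r (D ! 0)" "col c r (D ! 3)"
  shows "\<exists>s. s \<in> V - set D \<and> col c s (D ! 1) \<and> col c s (D ! 3) \<and> col c s (D ! (2 * k - 3))"
    and "\<And>s. s \<in> V - set D \<Longrightarrow> col c s (D ! 1) \<Longrightarrow> \<not> col c s (D ! (2 * k - 2))"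
proof -
  have len5: "5 \<le> length D" using D by linarith
  then obtain x0 x1 x2 x3 x4 M where DM: "D = x0 # x1 # x2 # x3 # x4 # M"
    by (cases D; cases "tl D"; cases "tl (tl D)"; cases "tl (tl (tl D))"; cases "tl (tl (tl (tl D)))") auto
  have nocons: "\<not> (col c s (D ! i) \<and> col c s (D ! Suc i))" if "s \<in> V - set D" "Suc i < length D" for s i
  proof
    assume "col c s (D ! i) \<and> col c s (D ! Suc i)"
    moreover have "rotate1 D ! i = D ! Suc i" using that nth_rotate[of i D 1] by simp
    ultimately have "\<exists>L. cycle (col c) L \<and> length L = Suc (2 * k - 1)"
      using that D by (intro insert_consecutive[OF D(1,2), of s i]) auto
    then show False using no1 D(3) by simp
  qed
  have last: "last (x4 # M) = D ! (2 * k - 2)"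
  proof -
    have "last (x4 # M) = last D" by (simp add: DM)
    also have "\<dots> = D ! (length D - 1)" using len5 by (intro last_conv_nth) auto
    finally show ?thesis using D(2) by (simp add: numeral_2_eq_2)
  qed
  show B: "\<not> col c s (D ! (2 * k - 2))" if s: "s \<in> V - set D" "col c s (D ! 1)" for s
  proof
    assume "col c s (D ! (2 * k - 2))"
    moreover have "r \<noteq> s" using nocons[of r 0] r s len5 by auto
    ultimately have "cycle (col c) (x1 # x0 # r # x3 # (x4 # M) @ [s])"
      using D(1) r s last unfolding DM 
      by - (rule odd_cycle_extend_last[of c x0 x1 x2 x3 "x4 # M" r s], auto simp del: last.simps)
    moreover have "length (x1 # x0 # r # x3 # (x4 # M) @ [s]) = 2 * k"
      using D(2,3) unfolding DM by simp
    ultimately show False using no1 by blast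
  qed
  obtain s j where s: "s \<in> V - set D" and "j \<le> k - 1" and
    j: "\<And>p. p < k - 1 \<Longrightarrow> p < j \<Longrightarrow> col c s (D ! (2 * p + 1))"
       "\<And>p. p < k - 1 \<Longrightarrow> j \<le> p \<Longrightarrow> col c s (D ! (2 * p + 2))"
    using odd_cycle_halves[OF D V no1 no2] by blast
  \<comment> \<open>For \<open>j = 0\<close> the vertex \<open>s\<close> is joined to
    \<open>x2\<close> and \<open>x4\<close>, and \<open>odd_cycle_extend_next\<close> gives a cycle
    of length \<open>2 * k\<close>.\<close>
  have "j \<noteq> 0"
  proof
    assume "j = 0"
    then have s24: "col c s x2" "col c s x4" using j(2)[of 0] j(2)[of 1] D(3) DM by simp_all
    moreover have "r \<noteq> s" using nocons[of r 2] r s24 s len5 by (auto simp: DM numeral_3_eq_3)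
    ultimately have "cycle (col c) (x0 # r # x3 # x2 # s # x4 # M)"
      using D(1) r s unfolding DM 
      by - (rule odd_cycle_extend_next[of c x0 x1 x2 x3 x4 M r s], auto)
    moreover have "length (x0 # r # x3 # x2 # s # x4 # M) = 2 * k"
      using D(2,3) unfolding DM by simp
    ultimately show False using no1 by blast
  qed
  then have s1: "col c s (D ! 1)" using j(1)[of 0] D(3) by simp
  \<comment> \<open>For smaller \<open>j\<close> the vertex \<open>s\<close> would be joined to the
    last vertex of \<open>D\<close> as well as to \<open>D ! 1\<close>. So \<open>s\<close> is
    joined to all odd positions, and its gap runs from \<open>2 * k - 3\<close> to
    \<open>1\<close>.\<close>
  have "j = k - 1"
  proof (rule ccontr)
    assume "j \<noteq> k - 1"
    then have "col c s (D ! (2 * (k - 2) + 2))" using j(2)[of "k - 2"] D(3) \<open>j \<le> k - 1\<close> by simp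
    moreover have "2 * (k - 2) + 2 = 2 * k - 2" using D(3) by simp
    ultimately show False using B[OF s s1] by simp
  qed
  then have "col c s (D ! 3)" "col c s (D ! (2 * (k - 2) + 1))"
    using j(1)[of 1] j(1)[of "k - 2"] D(3) by (simp_all add: numeral_3_eq_3)
  moreover have "2 * (k - 2) + 1 = 2 * k - 3" using D(3) by simp
  ultimately show "\<exists>s. s \<in> V - set D \<and> col c s (D ! 1) \<and> col c s (D ! 3) \<and> col c s (D ! (2 * k - 3))"
    using s s1 by auto
qed

lemma even_cycle_of_odd_cycle:
  assumes C: "cycle (col c) C" "length C = 2 * k - 1" "3 \<le> k" and V: "3 * k - 1 \<le> card V"
  shows "\<exists>c L. cycle (col c) L \<and> length L = 2 * k"
proof (rule ccontr)
  assume "\<not> ?thesis"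
  then have no1: "\<nexists>L. cycle (col c) L \<and> length L = 2 * k"
    and no2: "\<nexists>L. cycle (col (\<not> c)) L \<and> length L = 2 * k" by blast+
  have rot: "cycle (col c) (rotate i C)" "length (rotate i C) = 2 * k - 1" "set (rotate i C) = set C" for i
    using C cycle_rotate by auto
  obtain r j where r: "r \<in> V - set C" and "j \<le> k - 1" and
    j: "\<And>p. p < k - 1 \<Longrightarrow> p < j \<Longrightarrow> col c r (C ! (2 * p + 1))"
       "\<And>p. p < k - 1 \<Longrightarrow> j \<le> p \<Longrightarrow> col c r (C ! (2 * p + 2))"
    using odd_cycle_halves[OF C V no1 no2] by blast
  \<comment> \<open>The switch at \<open>j\<close> is a gap of length three: from
    \<open>2 * k - 2\<close> to \<open>2\<close> if \<open>j = 0\<close>, from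
    \<open>2 * j - 1\<close> to \<open>2 * j + 2\<close> in the middle, and from
    \<open>2 * k - 3\<close> to \<open>1\<close> if \<open>j = k - 1\<close>.\<close>
  have "\<exists>i<2 * k - 1. col c r (C ! i) \<and> col c r (C ! ((i + 3) mod (2 * k - 1)))"
  proof -
    consider "j = 0" | "0 < j" "j < k - 1" | "j = k - 1" "0 < j" using \<open>j \<le> k - 1\<close> by linarith
    then show ?thesis
    proof cases
      case 1
      have e: "2 * (k - 2) + 2 = 2 * k - 2" "(2 * k - 2 + 3) = 2 + (2 * k - 1)" using C(3) by simp_all
      have "(2 + (2 * k - 1)) mod (2 * k - 1) = 2" using C(3) by (simp only: mod_add_self2) simp
      moreover have "col c r (C ! 2)" using j(2)[of 0] 1 C(3) by (simp add: numeral_2_eq_2)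
      moreover have "col c r (C ! (2 * k - 2))" using j(2)[of "k - 2"] 1 C(3) unfolding e(1) by simp
      moreover have "2 * k - 2 < 2 * k - 1" using C(3) by simp
      ultimately show ?thesis using e(2) by metis
    next
      case 2
      have e: "2 * (j - 1) + 1 = 2 * j - 1" "2 * j - 1 + 3 = 2 * j + 2" using 2 by simp_all
      have "(2 * j + 2) mod (2 * k - 1) = 2 * j + 2" using 2 by simp
      moreover have "col c r (C ! (2 * j - 1))" using j(1)[of "j - 1"] 2 unfolding e(1) by simp
      moreover have "col c r (C ! (2 * j + 2))" using j(2)[of j] 2 by simp
      moreover have "2 * j - 1 < 2 * k - 1" using 2 by simp
      ultimately show ?thesis using e(2) by metis
    next
      case 3
      have e: "2 * (k - 2) + 1 = 2 * k - 3" "2 * k - 3 + 3 = 1 + (2 * k - 1)" using C(3) by simp_all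
      have "(1 + (2 * k - 1)) mod (2 * k - 1) = 1" using C(3) by (simp only: mod_add_self2) simp
      moreover have "col c r (C ! 1)" using j(1)[of 0] 3 C(3) by simp
      moreover have "col c r (C ! (2 * k - 3))" using j(1)[of "k - 2"] 3 C(3) unfolding e(1) by simp
      moreover have "2 * k - 3 < 2 * k - 1" using C(3) by simp
      ultimately show ?thesis using e(2) by metis
    qed
  qed
  then obtain i where i: "i < 2 * k - 1" "col c r (C ! i)" "col c r (C ! ((i + 3) mod (2 * k - 1)))" by blast
  define D where "D = rotate i C"
  have D: "cycle (col c) D" "length D = 2 * k - 1" "set D = set C" using rot by (simp_all add: D_def)
  have rD: "col c r (D ! 0)" "col c r (D ! 3)" using i C(2,3) by (simp_all add: D_def nth_rotate)
  obtain s where s: "s \<in> V - set D" "col c s (D ! 1)" "col c s (D ! (2 * k - 3))"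
    using odd_cycle_shift(1)[OF D(1,2) C(3) V no1 no2] r rD D(3) by metis
  \<comment> \<open>Turning \<open>D\<close> so that the gap of \<open>s\<close> starts at position
    0 allows a second shift. The resulting \<open>t\<close> is joined to both
    \<open>D ! (2 * k - 2)\<close> and \<open>D ! 1\<close>, which the second part of
    \<open>odd_cycle_shift\<close> forbids.\<close>
  define D' where "D' = rotate (2 * k - 3) D"
  have D': "cycle (col c) D'" "length D' = 2 * k - 1" "set D' = set D"
    using D cycle_rotate by (auto simp: D'_def)
  have e: "2 * k - 3 + 3 = 1 + (2 * k - 1)" "2 * k - 3 + 1 = 2 * k - 2" using C(3) by simp_all
  have D'n: "D' ! 0 = D ! (2 * k - 3)" "D' ! 1 = D ! (2 * k - 2)" "D' ! 3 = D ! 1"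
  proof -
    show "D' ! 0 = D ! (2 * k - 3)" using D(2) C(3) by (simp add: D'_def nth_rotate)
    show "D' ! 1 = D ! (2 * k - 2)" using D(2) C(3) e(2) nth_rotate[of 1 D "2 * k - 3"] by (simp add: D'_def)
    have "(1 + (2 * k - 1)) mod (2 * k - 1) = 1" using C(3) by (simp only: mod_add_self2) simp
    then show "D' ! 3 = D ! 1" using D(2) C(3) e(1) nth_rotate[of 3 D "2 * k - 3"] by (simp add: D'_def)
  qed
  obtain t where t: "t \<in> V - set D'" "col c t (D' ! 1)" "col c t (D' ! 3)"
    using odd_cycle_shift(1)[OF D'(1,2) C(3) V no1 no2] s D'n D'(3) by metis
  then show False
    using odd_cycle_shift(2)[OF D(1,2) C(3) V no1 no2 _ rD, of t] r D(3) D'n D'(3) by simp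
qed

text \<open>The outside vertices with at least \<open>k\<close> neighbours of colour
  \<open>c\<close> on \<open>C\<close> form \<open>U\<close>, and all have the same alternating half
  \<open>N\<close> of \<open>C\<close> as neighbourhood there. Every vertex outside \<open>N\<close>
  then has at most one neighbour of colour \<open>c\<close> in
  \<open>(set C - N) \<union> U\<close>, so Jackson's theorem gives a cycle of length
  \<open>2 * k + 2\<close> in the other colour.\<close>

lemma longer_cycle_of_even_cycle:
  assumes C: "cycle (col c) C" "length C = 2 * k" "2 \<le> k" and V: "3 * k + 4 \<le> card V"
    and no: "\<nexists>c L. cycle (col c) L \<and> (length L = 2 * k + 1 \<or> length L = 2 * k + 2)"
  shows False
proof -
  have no1: "\<not> (cycle (col d) L \<and> length L = 2 * k + 1)" and no2: "\<not> (cycle (col d) L \<and> length L = 2 * k + 2)"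
    for d L using no by blast+
  define R where "R = V - set C"
  have CV: "set C \<subseteq> V" using C cycle_subset_V by blast
  have distC: "distinct C" using C by (simp add: cycle_def)
  have cC: "card (set C) = 2 * k" using distC C(2) by (simp add: distinct_card)
  have cR: "card R + 2 * k = card V"
    using CV cC card_mono[OF finite_V CV] by (simp add: R_def card_Diff_subset)
  define U where "U = {r \<in> R. k \<le> card (nb c r (set C))}"
  have finR: "finite R" using finite_V by (simp add: R_def)
  have blue: "k + 1 \<le> card (nb (\<not> c) r (set C))" if "r \<in> R - U" for r
  proof -
    have "card (nb c r (set C)) + card (nb (\<not> c) r (set C)) = 2 * k"
      using that CV cC by (subst card_nb_add) (auto simp: R_def)
    then show ?thesis using that by (auto simp: U_def)
  qed
  \<comment> \<open>By Jackson's theorem with bound \<open>k + 1\<close>, more such vertices would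
    give a cycle of length \<open>2 * k + 2\<close> in the other colour.\<close>
  have "card (R - U) \<le> k"
  proof (rule ccontr)
    assume "\<not> ?thesis"
    then obtain X where X: "X \<subseteq> R - U" "card X = k + 1"
      by (metis Suc_eq_plus1 not_less_eq_eq obtain_subset_with_card_n)
    have "\<exists>L. cycle (col (\<not> c)) L \<and> length L = 2 * card X"
      using X CV blue cC C(3) by (intro mono_cycle[of X "set C" "k + 1"]) (auto simp: R_def)
    then show False using no2 X by auto
  qed
  moreover have "card (R - U) = card R - card U" using finR by (intro card_Diff_subset) (auto simp: U_def)
  ultimately have cU: "4 \<le> card U" using cR V by linarith
  have finU: "finite U" using finR by (simp add: U_def)
  have half: "cycle (\<lambda>u v. u \<in> nb c r (set C) \<longleftrightarrow> v \<notin> nb c r (set C)) C" "card (nb c r (set C)) = k"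
    if r: "r \<in> U" for r
  proof -
    have "\<not> (C ! i \<in> nb c r (set C) \<and> rotate1 C ! i \<in> nb c r (set C))" if "i < length C" for i
    proof
      assume "C ! i \<in> nb c r (set C) \<and> rotate1 C ! i \<in> nb c r (set C)"
      then have "\<exists>L. cycle (col c) L \<and> length L = Suc (2 * k)"
        using that C r by (intro insert_consecutive[OF C(1,2), of r i]) (auto simp: nb_def U_def R_def)
      then show False using no1 by auto
    qed
    note ind = independent_half_of_cycle[OF C(1,2) this nb_subset]
    have "k \<le> card (nb c r (set C))" using r by (simp add: U_def)
    then show "cycle (\<lambda>u v. u \<in> nb c r (set C) \<longleftrightarrow> v \<notin> nb c r (set C)) C" "card (nb c r (set C)) = k"
      using ind by blast+
  qed
  note altn = half(1)
  obtain r1 where r1: "r1 \<in> U" using cU by fastforce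
  define N where "N = nb c r1 (set C)"
  have NC: "N \<subseteq> set C" by (simp add: N_def nb_subset)
  have same: "nb c r (set C) = N" if r: "r \<in> U" for r
  proof -
    let ?Q = "\<lambda>v. v \<in> nb c r (set C) \<longleftrightarrow> v \<in> N"
    have cyc2: "cycle (\<lambda>u v. col c u v \<and> (u \<in> nb c r (set C) \<longleftrightarrow> v \<notin> nb c r (set C)) \<and> (u \<in> N \<longleftrightarrow> v \<notin> N)) C"
      unfolding N_def by (intro cycle_conj C altn r r1)
    then have "successively (\<lambda>u v. col c u v \<and> (u \<in> nb c r (set C) \<longleftrightarrow> v \<notin> nb c r (set C)) \<and> (u \<in> N \<longleftrightarrow> v \<notin> N)) C"
      by (simp add: cycle_def)
    then have "successively (\<lambda>u v. ?Q u \<longleftrightarrow> ?Q v) C"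
      by (rule successively_mono) blast
    then have const: "?Q v \<longleftrightarrow> ?Q (hd C)" if "v \<in> set C" for v by (rule successively_const[OF _ that])
    \<comment> \<open>If \<open>r\<close> and \<open>r1\<close> had complementary halves, both could
      be inserted: the new cycle runs \<open>a\<close>, \<open>s\<close>, \<open>d\<close>, back to
      \<open>b\<close>, then \<open>t\<close>, \<open>e\<close>.\<close>
    have "?Q (hd C)"
    proof (rule ccontr)
      assume nQ: "\<not> ?Q (hd C)"
      have "length C \<ge> 4" using C by simp
      then obtain a b d e M where M: "C = a # b # d # e # M"
        by (cases C; cases "tl C"; cases "tl (tl C)"; cases "tl (tl (tl C))") auto
      have "\<exists>s t. {s, t} = {r, r1} \<and> col c s a \<and> col c s d \<and> col c t b \<and> col c t e"
        using cyc2 nQ const unfolding M by (auto simp: cycle_def nb_def N_def)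
      then obtain s t where st: "{s, t} = {r, r1}" "col c s a" "col c s d" "col c t b" "col c t e" by blast
      have "s \<notin> set C" "t \<notin> set C" using st(1) r r1 by (auto simp: U_def R_def doubleton_eq_iff)
      moreover have "s \<noteq> t" using nQ st(1) by (auto simp: N_def)
      ultimately have "cycle (col c) (a # s # d # b # t # e # M)"
        using C(1) st unfolding M by (auto simp: cycle_def col_sym)
      then show False using no2[of c "a # s # d # b # t # e # M"] C(2) M by simp
    qed
    then have "v \<in> nb c r (set C) \<longleftrightarrow> v \<in> N" if "v \<in> set C" for v using const that by blast
    then show ?thesis using NC nb_subset by blast
  qed
  \<comment> \<open>The alternation is part of the edge relation, so that it survives rotations of \<open>C\<close>.\<close>
  define alt where "alt = (\<lambda>u v. col c u v \<and> (u \<in> N \<longleftrightarrow> v \<notin> N))"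
  have Calt: "cycle alt C" unfolding alt_def N_def by (intro cycle_conj C altn r1)
  have alt_col: "cycle (col c) K" if "cycle alt K" for K
    using that by (rule cycle_mono) (simp add: alt_def)
  have cN: "card N = k" using half(2)[OF r1] by (simp add: N_def)
  define Q where "Q = (set C - N) \<union> U"
  have QV: "Q \<subseteq> V - N" using CV NC by (auto simp: Q_def U_def R_def)
  have UN: "col c r x \<longleftrightarrow> x \<in> N" if "r \<in> U" "x \<in> set C" for r x
    using same[OF that(1)] that(2) by (auto simp: nb_def)
  have UC: "r \<notin> set C" "r \<in> V" if "r \<in> U" for r using that by (auto simp: U_def R_def)
  \<comment> \<open>With \<open>C\<close> cut into \<open>x\<close>, \<open>K1\<close>,
    \<open>y\<close>, \<open>K2\<close>, the new cycle crosses from \<open>x\<close> through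
    \<open>mid\<close> to \<open>y\<close>, follows \<open>K2\<close>, and returns through
    \<open>r\<close> and backwards along \<open>K1\<close>. The ends of \<open>K1\<close> and
    \<open>K2\<close> are joined to \<open>r\<close> because they precede \<open>y\<close> and
    \<open>x\<close> on \<open>C\<close> and so lie in \<open>N\<close>.\<close>
  have crossing: "\<exists>M. cycle (col c) (x # mid @ y # M) \<and> length (x # mid @ y # M) = 2 * k + 1 + length mid"
    if xy: "x \<in> set C - N" "y \<in> set C - N" "x \<noteq> y" and r: "r \<in> U" "r \<notin> set mid"
      and mid: "successively (col c) (x # mid @ [y])" "distinct mid" "set mid \<inter> set C = {}" for x y mid r
  proof -
    obtain K where K: "cycle alt (x # K)" "set (x # K) = set C" "length (x # K) = length C"
      using cycle_start_at[OF Calt] xy by blast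
    have "y \<in> set K" using K xy by auto
    then obtain K1 K2 where K12: "K = K1 @ y # K2" by (meson split_list)
    have "K1 \<noteq> []"
    proof
      assume "K1 = []"
      then have "alt x y" using K(1) K12 by (simp add: cycle_def)
      then show False using xy by (simp add: alt_def)
    qed
    have "K2 \<noteq> []"
    proof
      assume "K2 = []"
      then have "alt y x" using K(1) K12 by (simp add: cycle_def)
      then show False using xy by (simp add: alt_def)
    qed
    have ends: "alt (last K1) y" "alt (last K2) x" "alt x (hd K1)"
      using K(1) K12 \<open>K1 \<noteq> []\<close> \<open>K2 \<noteq> []\<close> by (auto simp: cycle_def successively_append_iff successively_Cons)
    have last12: "last K1 \<in> set C" "last K2 \<in> set C"
      using K(2) K12 last_in_set[OF \<open>K1 \<noteq> []\<close>] last_in_set[OF \<open>K2 \<noteq> []\<close>] by auto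
    have rr: "col c r (last K1)" "col c r (last K2)"
      using UN[OF r(1)] last12 ends xy by (auto simp: alt_def)
    have succ: "successively (col c) K1" "successively (col c) (y # K2)"
      using alt_col[OF K(1)] K12 by (auto simp: cycle_def successively_append_iff successively_Cons)
    have "successively (col c) (rev K1)" by (rule successively_rev_sym[OF succ(1) col_sym])
    moreover have "col c r (hd (rev K1))" "col c (last (rev K1)) x" "col c (last K2) r"
      using rr ends \<open>K1 \<noteq> []\<close> col_sym by (auto simp: hd_rev last_rev alt_def)
    ultimately have s1: "successively (col c) (y # K2 @ r # rev K1)"
      using succ(2) \<open>K1 \<noteq> []\<close> \<open>K2 \<noteq> []\<close>
      by (simp add: successively_append_iff successively_Cons[of _ y] successively_Cons[of _ r] del: successively_rev)
    have m: "successively (col c) (x # mid)" "col c (last (x # mid)) y"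
      using mid(1) successively_append_iff[of "col c" "x # mid" "[y]"] by simp_all
    have "successively (col c) ((x # mid) @ (y # K2 @ r # rev K1))"
      unfolding successively_append_iff[of "col c" "x # mid" "y # K2 @ r # rev K1"]
      using m s1 by (intro conjI disjI2) simp_all
    moreover have "distinct ((x # mid) @ (y # K2 @ r # rev K1))"
      using K(1,2) K12 mid(2,3) r UC[OF r(1)] by (auto simp: cycle_def)
    moreover have "col c (last ((x # mid) @ (y # K2 @ r # rev K1))) x"
      using \<open>col c (last (rev K1)) x\<close> \<open>K1 \<noteq> []\<close> by simp
    ultimately have "cycle (col c) (x # mid @ y # (K2 @ r # rev K1))" by (simp add: cycle_def)
    moreover have "length (x # mid @ y # (K2 @ r # rev K1)) = 2 * k + 1 + length mid"
      using K(3) K12 C(2) by simp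
    ultimately show ?thesis by blast
  qed
  \<comment> \<open>Two such neighbours would lengthen \<open>C\<close>: by a chord if
    \<open>v\<close> lies on \<open>C\<close>; otherwise by inserting \<open>v\<close> and a
    neighbour in \<open>U\<close>, by replacing the vertex between two vertices of \<open>N\<close>
    with a path through \<open>v\<close>, or by crossing via \<open>v\<close>.\<close>
  have one: "q = q'" if v: "v \<in> V - N" and q: "q \<in> Q" "q' \<in> Q" "col c v q" "col c v q'" for v q q'
  proof (rule ccontr)
    assume "q \<noteq> q'"
    have "\<not> U \<subseteq> {v}" using cU card_mono[of "{v}" U] by auto
    then obtain r where r: "r \<in> U" "r \<noteq> v" by auto
    show False
    proof (cases "v \<in> set C")
      case True
      then have "q \<notin> U" using UN[of q v] v q col_sym by blast
      then have "q \<in> set C - N" using q by (auto simp: Q_def)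
      moreover have "v \<noteq> q" using q(3) by auto
      ultimately obtain M where "cycle (col c) (v # [] @ q # M)" "length (v # [] @ q # M) = 2 * k + 1 + length ([] :: 'a list)"
        using crossing[of v q r "[]"] True v q r by auto
      then show False using no1[of c "v # q # M"] by simp
    next
      case False
      have UC2: False if "q \<in> U" "q' \<in> set C - N" "col c v q" "col c v q'" "q \<noteq> q'" for q q'
      proof -
        obtain K where K: "cycle alt (q' # K)" "set (q' # K) = set C" "length (q' # K) = length C"
          using cycle_start_at[OF Calt] \<open>q' \<in> set C - N\<close> by blast
        have "K \<noteq> []" using K(3) C by auto
        then obtain b M where M: "K = b # M" by (cases K) auto
        have "alt q' b" using K(1) M by (simp add: cycle_def)
        then have "b \<in> N" using that by (simp add: alt_def)
        then have "col c q b" using UN[of q b] that NC by auto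
        moreover have "v \<noteq> q" using that by auto
        moreover have "cycle (col c) (q' # b # M)" using alt_col[OF K(1)] M by simp
        ultimately have "cycle (col c) (q' # v # q # b # M)"
          using False that UC K(2) M by (auto simp: cycle_def col_sym)
        then show False using no2[of c "q' # v # q # b # M"] K(3) M C(2) by simp
      qed
      show False
      proof (cases "q \<in> U")
        case True
        show False
        proof (cases "q' \<in> U")
          case q'U: True
          have "N \<noteq> {}" using cN C(3) by auto
          then obtain a where a: "a \<in> N" by auto
          then obtain K where K: "cycle alt (a # K)" "set (a # K) = set C" "length (a # K) = length C"
            using cycle_start_at[OF Calt] NC by blast
          have "length K \<ge> 2" using K(3) C by simp
          then obtain b d M where M: "K = b # d # M" by (cases K; cases "tl K") auto
          have "alt a b" "alt b d" using K(1) M by (auto simp: cycle_def)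
          then have "d \<in> N" using a by (simp add: alt_def)
          then have "col c q a" "col c q' d" using UN[OF True] UN[OF q'U] a NC by auto
          moreover have "v \<noteq> q" "v \<noteq> q'" using q by auto
          moreover have "cycle (col c) (a # b # d # M)" using alt_col[OF K(1)] M by simp
          ultimately have "cycle (col c) (a # q # v # q' # d # M)"
            using False q \<open>q \<noteq> q'\<close> UC[OF True] UC[OF q'U] K(2) M
            by (auto simp: cycle_def col_sym split: if_splits)
          then show False using no2[of c "a # q # v # q' # d # M"] K(3) M C(2) by simp
        next
          case False
          then show False using UC2[of q q'] True q \<open>q \<noteq> q'\<close> by (auto simp: Q_def)
        qed
      next
        case False
        then have qC: "q \<in> set C - N" using q by (auto simp: Q_def)
        show False
        proof (cases "q' \<in> U")
          case True
          then show False using UC2[of q' q] qC q \<open>q \<noteq> q'\<close> by auto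
        next
          case False
          then have "q' \<in> set C - N" using q by (auto simp: Q_def)
          then obtain M where "cycle (col c) (q # [v] @ q' # M)" "length (q # [v] @ q' # M) = 2 * k + 1 + length [v]"
            using crossing[of q q' r "[v]"] qC q r \<open>q \<noteq> q'\<close> \<open>v \<notin> set C\<close> col_sym by auto
          then show False using no2[of c "q # [v] @ q' # M"] by simp
        qed
      qed
    qed
  qed
  have cQ: "k + 4 \<le> card Q"
  proof -
    have "card (set C - N) = k" using cC cN NC finite_subset[OF NC] by (simp add: card_Diff_subset)
    moreover have "card Q = card (set C - N) + card U"
      unfolding Q_def using finU by (intro card_Un_disjoint) (auto simp: U_def R_def)
    ultimately show ?thesis using cU by simp
  qed
  \<comment> \<open>The at least \<open>2 * k + 4\<close> vertices of \<open>V - N\<close> provide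
    \<open>k + 3\<close> for \<open>Y\<close> and \<open>k + 1\<close> for \<open>X\<close>; each
    vertex of \<open>X\<close> keeps at least \<open>k + 2\<close> neighbours in \<open>Y\<close> in
    the other colour.\<close>
  then obtain Y where Y: "Y \<subseteq> Q" "card Y = k + 3" 
    using obtain_subset_with_card_n[of "k + 3" Q] by auto
  have YV: "Y \<subseteq> V - N" using Y QV by blast
  have "card (V - N - Y) = card V - k - (k + 3)"
    using YV Y cN NC CV finite_V finite_subset[OF YV] finite_subset[of N V] by (simp add: card_Diff_subset)
  then have "k + 1 \<le> card (V - N - Y)" using V by linarith
  then obtain X where X: "X \<subseteq> V - N - Y" "card X = k + 1" by (meson obtain_subset_with_card_n)
  have "\<exists>L. cycle (col (\<not> c)) L \<and> length L = 2 * card X"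
  proof (rule mono_cycle)
    show "X \<subseteq> V" "Y \<subseteq> V" "X \<inter> Y = {}" using X YV by auto
    show "2 \<le> card X" "card X \<le> k + 2" "card Y + 2 \<le> 2 * (k + 2)" using X Y C(3) by auto
    fix x assume x: "x \<in> X"
    have "\<forall>q\<in>nb c x Y. \<forall>q'\<in>nb c x Y. q = q'"
      using one[of x] x X Y by (auto simp: nb_def)
    then have "card (nb c x Y) \<le> 1"
      using card_le_Suc0_iff_eq[OF finite_nb[of c x Y]] by simp
    moreover have "card (nb c x Y) + card (nb (\<not> c) x Y) = k + 3"
      using x X YV Y by (subst card_nb_add) auto
    ultimately show "k + 2 \<le> card (nb (\<not> c) x Y)" by linarith
  qed
  then show False using no2 X by auto
qed

text \<open>A longest monochromatic cycle of length between 4 and \<open>2 * q\<close> must have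
  length \<open>2 * q\<close>: one of length \<open>2 * k\<close> with \<open>k < q\<close> can be
  lengthened since \<open>3 * k + 4 <= 3 * q + 1\<close>, and an odd one by a single vertex.\<close>

lemma mono_even_cycle:
  assumes V: "3 * q + 1 \<le> card V" "10 \<le> card V" and q: "2 \<le> q"
  shows "\<exists>c L. cycle (col c) L \<and> length L = 2 * q"
proof -
  define S where "S = {m. 4 \<le> m \<and> m \<le> 2 * q \<and> (\<exists>c L. cycle (col c) L \<and> length L = m)}"
  have "4 \<in> S" using mono_4_cycle[OF V(2)] q by (auto simp: S_def)
  have "finite S" by (rule finite_subset[of _ "{..2 * q}"]) (auto simp: S_def)
  define m where "m = Max S"
  have mS: "m \<in> S" using \<open>4 \<in> S\<close> \<open>finite S\<close> by (auto simp: m_def intro: Max_in)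
  have max: "m' \<notin> S" if "m < m'" for m' using that Max_ge[OF \<open>finite S\<close>, of m'] by (auto simp: m_def)
  obtain c L where L: "cycle (col c) L" "length L = m" and m: "4 \<le> m" "m \<le> 2 * q" using mS by (auto simp: S_def)
  show ?thesis
  proof (cases "m = 2 * q")
    case True
    then show ?thesis using L by blast
  next
    case False
    have no: "\<nexists>c L. cycle (col c) L \<and> length L = m'" if "m < m'" "m' \<le> 2 * q" for m'
      using max[OF that(1)] that m by (auto simp: S_def)
    show ?thesis
    proof (cases "even m")
      case True
      then obtain k where k: "m = 2 * k" by blast
      then have "k < q" using False m by simp
      have "\<nexists>c L. cycle (col c) L \<and> (length L = 2 * k + 1 \<or> length L = 2 * k + 2)"
        using no[of "2 * k + 1"] no[of "2 * k + 2"] k \<open>k < q\<close> by auto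
      then show ?thesis
        using longer_cycle_of_even_cycle[of c L k] L k m V \<open>k < q\<close> by auto
    next
      case odd: False
      then obtain k where k: "m = 2 * k - 1" "1 \<le> k" 
      proof -
        obtain l where "m = 2 * l + 1" using odd by (blast elim: oddE)
        then show ?thesis using that[of "l + 1"] by simp
      qed
      then have "3 \<le> k" "k \<le> q" using m by linarith+
      then have "\<exists>c L. cycle (col c) L \<and> length L = 2 * k"
        using even_cycle_of_odd_cycle[of c L k] L k V by auto
      then show ?thesis using no[of "2 * k"] k \<open>k \<le> q\<close> \<open>3 \<le> k\<close> by auto
    qed
  qed
qed

subsection \<open>From even cycles to linked double stars\<close>

text \<open>The \<open>q - 2\<close> other vertices of \<open>F\<close> lie on an alternating cycle.
  Opened at one of them, it is joined to \<open>b\<close> through a further vertex \<open>y\<close>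
  of \<open>R\<close> and to \<open>b'\<close> directly. Then \<open>n + 1\<close> vertices of
  \<open>R\<close> remain, all joined to both ends, and \<open>z\<close> is the one leaf still
  missing.\<close>

lemma star_of_complete_vertices:
  assumes FR: "F \<subseteq> V" "R \<subseteq> V" "F \<inter> R = {}" and cF: "card F = q" and cR: "card R = n + q"
    and deg: "\<And>x. x \<in> F \<Longrightarrow> q \<le> card (nb c x R)"
    and b: "b \<in> F" "b' \<in> F" "b \<noteq> b'" "\<And>r. r \<in> R \<Longrightarrow> col c b r" "\<And>r. r \<in> R \<Longrightarrow> col c b' r"
    and z: "z \<notin> F \<union> R" "col c b z" and n: "2 \<le> n" "n + 3 \<le> q"
  shows "has_star c (2 * q - 1) n 2"
proof -
  have fin: "finite F" "finite R" using FR finite_V by (auto intro: finite_subset)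
  define X where "X = F - {b, b'}"
  have cX: "card X = q - 2" using b cF fin by (simp add: X_def card_Diff_subset)
  obtain L where L: "cycle (\<lambda>u v. col c u v \<and> (u \<in> X \<longleftrightarrow> v \<in> R)) L" "length L = 2 * card X"
    "set L \<subseteq> X \<union> R" "X \<subseteq> set L"
    by (rule alternating_cycle[of X R q c]) (use FR deg cX cR n in \<open>auto simp: X_def\<close>)
  have "X \<noteq> {}" using cX n by auto
  then obtain x where x: "x \<in> X" by auto
  then obtain M where M: "cycle (\<lambda>u v. col c u v \<and> (u \<in> X \<longleftrightarrow> v \<in> R)) (x # M)"
    "set (x # M) = set L" "length (x # M) = length L"
    using cycle_start_at[OF L(1)] L(4) by blast
  have path: "successively (col c) (x # M)" "distinct (x # M)"
    using M(1) unfolding cycle_def by (auto intro: successively_mono)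
  have lastR: "last (x # M) \<in> R"
  proof -
    have "x \<notin> R" using x FR by (auto simp: X_def)
    moreover have "last (x # M) \<in> X \<longleftrightarrow> x \<in> R" using M(1) by (simp add: cycle_def)
    moreover have "last (x # M) \<in> X \<union> R" using L(3) M(2) last_in_set[of "x # M"] by auto
    ultimately show ?thesis by auto
  qed
  have cLR: "card (set L \<inter> R) = q - 2"
  proof -
    have "card (set L) = 2 * (q - 2)" using L(1,2) cX by (simp add: cycle_def distinct_card)
    moreover have "set L = X \<union> set L \<inter> R" using L by auto
    moreover have "card (X \<union> set L \<inter> R) = card X + card (set L \<inter> R)"
      using fin FR by (intro card_Un_disjoint) (auto simp: X_def)
    ultimately show ?thesis using cX by simp
  qed
  have "card (nb c x R \<inter> set L) \<le> card (set L \<inter> R)"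
    using fin by (intro card_mono) (auto simp: nb_def)
  then have "card (nb c x R \<inter> set L) < card (nb c x R)" using cLR deg[of x] x n by (auto simp: X_def)
  then have "nb c x R \<inter> set L \<noteq> nb c x R" by auto
  then obtain y where y: "y \<in> R" "col c x y" "y \<notin> set L" by (auto simp: nb_def)
  define P where "P = b # y # (x # M) @ [b']"
  have bR: "b \<notin> R" "b' \<notin> R" "b \<notin> X" "b' \<notin> X" using b FR by (auto simp: X_def)
  have distP: "distinct P"
    using path(2) y bR b L(3) M(2) unfolding P_def by auto
  have pathP: "successively (col c) P"
  proof -
    have "successively (col c) ((x # M) @ [b'])"
      using path(1) b(5)[OF lastR] col_sym by (simp only: successively_append_iff) simp
    then show ?thesis using y b(4) col_sym[OF y(2)] by (simp add: P_def)
  qed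
  have setP: "set P = insert b (insert b' (insert y (set L)))" using M(2) by (auto simp: P_def)
  have "R - set P = R - insert y (set L \<inter> R)" using bR setP by auto
  moreover have "card (insert y (set L \<inter> R)) = q - 1" using y cLR n by simp
  ultimately have cRP: "card (R - set P) = n + 1"
    using fin y cR n by (subst (asm) (1) eq_commute) (simp add: card_Diff_subset)
  show ?thesis
  proof (rule has_starI[where D = "insert z (R - set P)" and E = "R - set P" and P = P])
    show "P \<noteq> []" "distinct P" "successively (col c) P" using distP pathP by (auto simp: P_def)
    show "length P = 2 * q - 1" using M(3) L(2) cX n by (simp add: P_def)
    have zP: "z \<notin> set P" using z L(3) y b setP by (auto simp: X_def)
    then show "insert z (R - set P) \<inter> set P = {}" "(R - set P) \<inter> set P = {}" by auto
    show "col c (hd P) a" if "a \<in> insert z (R - set P)" for a using that z b by (auto simp: P_def)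
    show "col c (last P) a" if "a \<in> R - set P" for a using that b by (auto simp: P_def)
    have "insert z (R - set P) \<union> (R - set P) = insert z (R - set P)" by auto
    moreover have "card (insert z (R - set P)) = n + 2" using z fin cRP by simp
    ultimately show "n \<le> card (insert z (R - set P))"
      "n + 2 \<le> card (insert z (R - set P) \<union> (R - set P))" by simp_all
    show "2 \<le> card (R - set P)" using cRP n by simp
  qed
qed

lemma star_of_even_cycle:
  assumes C: "cycle (col c) C" "length C = 2 * q" and cV: "card V = n + 3 * q"
    and n: "2 \<le> n" "n + 3 \<le> q"
  shows "has_star c (2 * q - 1) n 2 \<or> has_star (\<not> c) (2 * q - 1) n 2"
proof (rule ccontr)
  assume nostar: "\<not> ?thesis"
  define R where "R = V - set C"
  define L where "L = {x \<in> set C. n + 1 \<le> card (nb c x R)}"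
  define F where "F = set C - L"
  define B where "B = {x \<in> set C. nb c x R = {}}"
  have distC: "distinct C" and Cne: "C \<noteq> []" using C by (auto simp: cycle_def)
  have CV: "set C \<subseteq> V" using cycle_subset_V[OF C(1)] .
  have RV: "R \<subseteq> V" by (auto simp: R_def)
  have cC: "card (set C) = 2 * q" using C(2) distC by (simp add: distinct_card)
  have cR: "card R = n + q" unfolding R_def using CV cC cV by (simp add: card_Diff_subset)
  have degF: "q \<le> card (nb (\<not> c) x R)" if "x \<in> F" for x
  proof -
    have "card (nb c x R) + card (nb (\<not> c) x R) = n + q"
      using that CV RV cR card_nb_add[of x R c] by (auto simp: F_def R_def)
    then show ?thesis using that by (auto simp: F_def L_def)
  qed
  have finF: "finite F" and finL: "finite L" and finB: "finite B" by (auto simp: F_def L_def B_def)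
  have FV: "F \<subseteq> V" "F \<inter> R = {}" using CV by (auto simp: F_def R_def)
  have LC: "L \<subseteq> set C" by (auto simp: L_def)
  have cFL: "card F + card L = 2 * q"
    using cC card_Diff_subset[OF finL LC] card_mono[OF _ LC] by (simp add: F_def)
  \<comment> \<open>Otherwise \<open>F\<close> and \<open>R\<close> contain a star in the other
    colour. Hence \<open>card L >= q - n >= 3\<close>.\<close>
  have "\<not> n + q + 1 \<le> card F"
    using star_in_dense_bipartite[OF FV(1) RV FV(2) cR _ degF n] nostar by blast
  then have cL: "3 \<le> card L" using cFL n by linarith
  have BF: "B \<subseteq> F" by (auto simp: B_def F_def L_def)
  have LB: "L \<inter> B = {}" by (auto simp: B_def L_def)
  have Bcol: "col (\<not> c) b r" if "b \<in> B" "r \<in> R" for b r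
    using that not_col[of b r c] CV by (auto simp: B_def R_def nb_def)
  have rot: "cycle (col c) (rotate i C)" for i using cycle_rotate[OF C(1)] .
  have shape: "\<exists>y M. rotate i C = C ! i # y # rotate 2 C ! i # M" if "i < 2 * q" for i
  proof -
    have "length (rotate i C) \<ge> 3" using C(2) n by simp
    then obtain x y z M where D: "rotate i C = x # y # z # M"
      by (cases "rotate i C"; cases "tl (rotate i C)"; cases "tl (tl (rotate i C))") auto
    have "rotate i C ! 0 = C ! i" "rotate i C ! 2 = rotate 2 C ! i"
      using that C(2) n by (simp_all add: nth_rotate add.commute)
    then have "x = C ! i" "z = rotate 2 C ! i" unfolding D by simp_all
    then show ?thesis unfolding D by blast
  qed
  have LtoB: "rotate 2 C ! i \<in> B" if i: "i < 2 * q" "C ! i \<in> L" for i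
  proof (rule ccontr)
    assume "\<not> ?thesis"
    define x z where "x = C ! i" and "z = rotate 2 C ! i"
    obtain y M where D: "rotate i C = x # y # z # M" using shape[OF i(1)] by (auto simp: x_def z_def)
    have setD: "set (x # y # z # M) = set C" by (metis D set_rotate)
    have cycD: "cycle (col c) (x # y # z # M)" using rot[of i] D by simp
    have "z \<in> set C" using setD by auto
    then have "nb c z R \<noteq> {}" using \<open>rotate 2 C ! i \<notin> B\<close> by (auto simp: B_def z_def)
    then obtain r where r: "r \<in> R" "col c z r" by (auto simp: nb_def)
    \<comment> \<open>The path goes from \<open>x\<close> to \<open>z\<close> the long way round
      \<open>C\<close> and leaves out only \<open>y\<close>. This vertex serves as a leaf of
      \<open>z\<close> and, lying outside \<open>R\<close>, brings the union of the leaf sets to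
      \<open>n + 2\<close>.\<close>
    define P where "P = x # rev (z # M)"
    have "has_star c (2 * q - 1) n 2"
    proof (rule has_starI[where D = "nb c x R" and E = "{y, r}" and P = P])
      show "P \<noteq> []" by (simp add: P_def)
      show "length P = 2 * q - 1" using C(2) arg_cong[OF D, of length] by (simp add: P_def)
      show "distinct P" using cycD by (auto simp: P_def cycle_def)
      have "successively (col c) (z # M)" "col c x (last (z # M))"
        using cycD col_sym[of c "last (z # M)" x] by (simp_all add: cycle_def successively_Cons)
      then show "successively (col c) P"
        using successively_rev_sym[of "col c" "z # M", OF _ col_sym]
        by (cases "M = []") (simp_all add: P_def successively_Cons hd_append hd_rev del: successively_rev)
      have PC: "set P \<subseteq> set C" using setD by (auto simp: P_def)
      then show "nb c x R \<inter> set P = {}" by (auto simp: nb_def R_def)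
      have "y \<notin> set P" using cycD by (auto simp: P_def cycle_def)
      then show "{y, r} \<inter> set P = {}" using PC r by (auto simp: R_def)
      show "col c (hd P) a" if "a \<in> nb c x R" for a using that by (simp add: P_def nb_def)
      show "col c (last P) a" if "a \<in> {y, r}" for a
        using that r cycD by (auto simp: P_def cycle_def col_sym)
      have yR: "y \<notin> R" using setD by (auto simp: R_def)
      then have "y \<noteq> r" using r by blast
      then show "2 \<le> card {y, r}" by simp
      have xL: "n + 1 \<le> card (nb c x R)" using i by (simp add: L_def x_def)
      then show "n \<le> card (nb c x R)" by simp
      have "n + 2 \<le> card (insert y (nb c x R))" using yR xL nb_subset[of c x R] by (subst card_insert_disjoint) auto
      also have "\<dots> \<le> card (nb c x R \<union> {y, r})" by (intro card_mono) auto
      finally show "n + 2 \<le> card (nb c x R \<union> {y, r})" .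
    qed
    then show False using nostar by blast
  qed
  \<comment> \<open>Two steps along \<open>C\<close> map \<open>L\<close> injectively into
    \<open>B\<close>.\<close>
  have cB: "card L \<le> card B"
  proof -
    let ?I = "{i. i < 2 * q \<and> C ! i \<in> L}"
    have "bij_betw ((!) C) ?I L"
      unfolding bij_betw_def using distC C(2) LC
      by (auto simp: inj_on_def nth_eq_iff_index_eq image_iff in_set_conv_nth subset_iff)
    then have "card ?I = card L" by (rule bij_betw_same_card)
    moreover have "card ?I \<le> card B"
    proof (rule card_inj_on_le[of "\<lambda>i. rotate 2 C ! i"])
      show "inj_on (\<lambda>i. rotate 2 C ! i) ?I" using distC C(2) by (auto simp: inj_on_def nth_eq_iff_index_eq)
    qed (use LtoB finB in auto)
    ultimately show ?thesis by simp
  qed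
  have "card B \<le> card F" using BF finF by (rule card_mono[rotated])
  then have cF: "q \<le> card F" using cB cFL by linarith
  have B3: "3 \<le> card B" using cL cB by linarith
  \<comment> \<open>Otherwise \<open>z\<close> is the extra leaf in
    \<open>star_of_complete_vertices\<close>, applied to \<open>q\<close> vertices of
    \<open>F\<close> other than \<open>z\<close>; hence the condition on
    \<open>F - {z}\<close>.\<close>
  have Bred: "col c b z" if bz: "b \<in> B" "z \<in> set C" "b \<noteq> z" and F: "q \<le> card (F - {z})" for b z
  proof (rule ccontr)
    assume "\<not> ?thesis"
    then have blue: "col (\<not> c) b z" using bz CV not_col[of b z c] by (auto simp: B_def)
    have "\<not> B \<subseteq> {b, z}" using B3 bz card_mono[of "{b, z}" B] by auto
    then obtain b' where b': "b' \<in> B" "b' \<noteq> b" "b' \<noteq> z" by auto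
    have bb: "{b, b'} \<subseteq> F - {z}" using b' bz BF by auto
    have "card {b, b'} \<le> q" using n by (simp add: card_insert_if)
    then obtain F0 where F0: "{b, b'} \<subseteq> F0" "F0 \<subseteq> F - {z}" "card F0 = q"
      using exists_subset_between[OF _ F bb] finF by blast
    have "has_star (\<not> c) (2 * q - 1) n 2"
      by (rule star_of_complete_vertices[of F0 R q n "\<not> c" b b' z])
         (use F0 FV RV cR degF b' bz Bcol blue n in \<open>auto simp: R_def\<close>)
    then show False using nostar by blast
  qed
  show False
  proof (cases "card F = q")
    case False
    then have "q + 1 \<le> card F" using cF by simp
    moreover have "card F - 1 \<le> card (F - {z})" for z using finF by (simp add: card_Diff_singleton_if)
    ultimately have "q \<le> card (F - {z})" for z by (meson add_le_imp_le_diff le_trans)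
    then have Bred': "col c b z" if "b \<in> B" "z \<in> set C" "b \<noteq> z" for b z using that Bred by blast
    have "L \<noteq> {}" using cL by auto
    then obtain i where i: "i < 2 * q" "C ! i \<in> L" using LC C(2) by (metis ex_in_conv in_set_conv_nth subsetD)
    define x z where "x = C ! i" and "z = rotate 2 C ! i"
    have zB: "z \<in> B" using LtoB[OF i] by (simp add: z_def)
    obtain y M where D: "rotate i C = x # y # z # M" using shape[OF i(1)] by (auto simp: x_def z_def)
    have setD: "set (x # y # z # M) = set C" by (metis D set_rotate)
    have cycD: "cycle (col c) (x # y # z # M)" using rot[of i] D by simp
    have "\<not> L \<subseteq> {x, y}" using cL card_mono[of "{x, y}" L] card_insert_le_m1[of 2 "{y}" x] by auto
    then obtain v where v: "v \<in> L" "v \<noteq> x" "v \<noteq> y" by auto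
    then have "v \<in> set M" using LC setD zB LB by auto
    then obtain M1 M2 where M12: "M = M1 @ v # M2" by (meson split_list)
    have zC: "z \<in> set C" using setD by auto
    \<comment> \<open>The order on \<open>C\<close> is \<open>x\<close>, \<open>y\<close>,
      \<open>z\<close>, \<open>M1\<close>, \<open>v\<close>, \<open>M2\<close>. The path runs from
      \<open>x\<close> backwards through \<open>M2\<close>, jumps to \<open>z\<close> and goes
      forward to \<open>v\<close>; the jump has colour \<open>c\<close> because \<open>z\<close>
      lies in \<open>B\<close>. Both ends lie in \<open>L\<close>, and \<open>y\<close> is free as a
      leaf of \<open>x\<close>.\<close>
    define P where "P = x # rev M2 @ z # M1 @ [v]"
    have "has_star c (2 * q - 1) n 2"
    proof (rule has_starI[where D = "insert y (nb c x R)" and E = "nb c v R" and P = P])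
      show "P \<noteq> []" by (simp add: P_def)
      show "length P = 2 * q - 1" using C(2) arg_cong[OF D, of length] M12 by (simp add: P_def)
      show "distinct P" using cycD M12 by (auto simp: P_def cycle_def)
      have zz: "col c u z" if "u \<in> set C" "u \<noteq> z" for u using Bred'[OF zB that(1)] that col_sym by auto
      have s1: "successively (col c) (z # M1 @ [v])" "successively (col c) M2"
        using cycD M12 by (cases "M1 = []"; auto simp: cycle_def successively_Cons successively_append_iff)+
      then have s2: "successively (col c) (rev M2)" by (blast intro: successively_rev_sym col_sym)
      show "successively (col c) P"
      proof (cases "M2 = []")
        case True
        have "col c x z" using zz[of x] cycD setD by (auto simp: cycle_def)
        then show ?thesis using s1 True by (simp add: P_def)
      next
        case False
        have "hd M2 \<in> set M2" using False by simp
        then have "hd M2 \<in> set C" "hd M2 \<noteq> z" using cycD setD M12 by (auto simp: cycle_def)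
        then have "col c (hd M2) z" by (rule zz)
        moreover have "col c x (last M2)" using cycD M12 False by (auto simp: cycle_def col_sym)
        ultimately show ?thesis using s1(1) s2 False unfolding P_def
          by (simp add: successively_append_iff successively_Cons[of _ x] hd_rev last_rev del: successively_rev)
      qed
      have PC: "set P \<subseteq> set C" using setD M12 by (auto simp: P_def)
      have yP: "y \<notin> set P" using cycD M12 by (auto simp: P_def cycle_def)
      then show "insert y (nb c x R) \<inter> set P = {}" using PC by (auto simp: nb_def R_def)
      show "nb c v R \<inter> set P = {}" using PC by (auto simp: nb_def R_def)
      show "col c (hd P) a" if "a \<in> insert y (nb c x R)" for a
        using that cycD by (auto simp: P_def nb_def cycle_def)
      show "col c (last P) a" if "a \<in> nb c v R" for a using that by (auto simp: P_def nb_def)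
      have yR: "y \<notin> R" using setD by (auto simp: R_def)
      have xL: "n + 1 \<le> card (nb c x R)" using i by (simp add: L_def x_def)
      have xy: "n + 2 \<le> card (insert y (nb c x R))" using yR xL nb_subset[of c x R] by (subst card_insert_disjoint) auto
      then show "n \<le> card (insert y (nb c x R))" by simp
      show "2 \<le> card (nb c v R)" using v n by (auto simp: L_def)
      have "card (insert y (nb c x R)) \<le> card (insert y (nb c x R) \<union> nb c v R)"
        by (intro card_mono) auto
      then show "n + 2 \<le> card (insert y (nb c x R) \<union> nb c v R)" using xy by linarith
    qed
    then show False using nostar by blast
  next
    case True
    then have cL': "card L = q" using cFL by simp
    then have "B = F" using card_seteq[OF finF BF] cB cFL True by simp
    have LBcol: "col c l b" if "l \<in> L" "b \<in> B" for l b
    proof -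
      have "F - {l} = F" using that by (auto simp: F_def)
      then have "col c b l" using Bred[of b l] that LC LB True \<open>B = F\<close> by auto
      then show ?thesis by (rule col_sym)
    qed
    have LV: "L \<subseteq> V" "B \<subseteq> V" using LC CV BF FV by auto
    have nbL: "nb c l B = B" if "l \<in> L" for l using that LBcol by (auto simp: nb_def)
    \<comment> \<open>Now \<open>C\<close> splits into \<open>L\<close> and \<open>B\<close>, both
      of size \<open>q\<close> and completely joined in colour \<open>c\<close>. Removing a vertex
      \<open>b\<close> of \<open>B\<close> from an alternating Hamiltonian cycle leaves a path with
      both ends in \<open>L\<close>, and \<open>b\<close> is the extra leaf.\<close>
    obtain K where K: "cycle (\<lambda>u v. col c u v \<and> (u \<in> L \<longleftrightarrow> v \<in> B)) K" "length K = 2 * card L"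
      "set K \<subseteq> L \<union> B" "L \<subseteq> set K"
      by (rule alternating_cycle[OF LV LB, of q c]) (use nbL cL' True \<open>B = F\<close> n in auto)
    have "card (set K) = 2 * q" using K cL' by (simp add: cycle_def distinct_card)
    moreover have "card L < 2 * q" using cL' n by simp
    ultimately have "\<not> set K \<subseteq> L" using finL card_mono leD by metis
    then obtain b where b: "b \<in> B" "b \<in> set K" using K(3) by auto
    then obtain M where M: "cycle (\<lambda>u v. col c u v \<and> (u \<in> L \<longleftrightarrow> v \<in> B)) (b # M)"
      "set (b # M) = set K" "length (b # M) = length K"
      using cycle_start_at[OF K(1)] by blast
    have lenM: "length M = 2 * q - 1" using M(3) K(2) cL' by simp
    then have Mne: "M \<noteq> []" using n by auto
    have hdM: "col c b (hd M)" "b \<in> L \<longleftrightarrow> hd M \<in> B" "col c (last M) b" "last M \<in> L \<longleftrightarrow> b \<in> B"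
      using M(1) Mne by (auto simp: cycle_def successively_Cons)
    have MLB: "hd M \<in> L \<union> B" using K(3) M(2) Mne by (metis (no_types) hd_in_set list.set_intros(2) subsetD)
    have ends: "hd M \<in> L" "last M \<in> L" using hdM MLB b LB by auto
    have "has_star c (2 * q - 1) n 2"
    proof (rule has_starI[where D = "insert b (nb c (hd M) R)" and E = "nb c (last M) R" and P = M])
      show "M \<noteq> []" "length M = 2 * q - 1" using Mne lenM by auto
      show "distinct M" "successively (col c) M"
        using M(1) by (auto simp: cycle_def successively_Cons intro: successively_mono)
      have MC: "set M \<subseteq> set C" using M(2) K(3) LC by (auto simp: B_def)
      have "b \<notin> set M" using M(1) by (simp add: cycle_def)
      then show "insert b (nb c (hd M) R) \<inter> set M = {}" using MC by (auto simp: nb_def R_def)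
      show "nb c (last M) R \<inter> set M = {}" using MC by (auto simp: nb_def R_def)
      show "col c (hd M) a" if "a \<in> insert b (nb c (hd M) R)" for a
        using that hdM(1) by (auto simp: nb_def col_sym)
      show "col c (last M) a" if "a \<in> nb c (last M) R" for a using that by (auto simp: nb_def)
      have bR: "b \<notin> R" using b by (auto simp: R_def B_def)
      have xL: "n + 1 \<le> card (nb c (hd M) R)" using ends by (simp add: L_def)
      have xy: "n + 2 \<le> card (insert b (nb c (hd M) R))" using bR xL nb_subset[of c "hd M" R] by (subst card_insert_disjoint) auto
      then show "n \<le> card (insert b (nb c (hd M) R))" by simp
      show "2 \<le> card (nb c (last M) R)" using ends n by (auto simp: L_def)
      have "card (insert b (nb c (hd M) R)) \<le> card (insert b (nb c (hd M) R) \<union> nb c (last M) R)"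
        by (intro card_mono) auto
      then show "n + 2 \<le> card (insert b (nb c (hd M) R) \<union> nb c (last M) R)" using xy by linarith
    qed
    then show False using nostar by blast
  qed
qed

end

section \<open>Turning the star into an embedding of the graph\<close>

theorem theorem3p2:
  fixes p c n :: nat
  assumes "p \<ge> 1"
    and "c = 2 * p + 1"
    and "2 \<le> n" and "n \<le> p - 2"
  shows "ramsey_number (linked_double_star c n 2) \<le> n + 3 * p + 3"
proof -
  define q where "q = p + 1"
  define N where "N = n + 3 * p + 3"
  \<comment> \<open>Because \<open>2 <= n\<close>, the bound by the truncated \<open>p - 2\<close>
    forces \<open>p >= 4\<close>, so it does mean \<open>n + 2 <= p\<close>.\<close>
  have n: "2 \<le> n" "n + 3 \<le> q" using assms by (auto simp: q_def)
  have NV: "card {..<N} = n + 3 * q" by (simp add: N_def q_def)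
  have c: "c = 2 * q - 1" "1 \<le> c" using assms by (auto simp: q_def)
  have "mono_copy (linked_double_star c n 2) N g" if g: "g \<in> [{..<N}]\<^bsup>2\<^esup> \<rightarrow> {..<2}" for g
  proof -
    interpret two_colouring "{..<N}" "\<lambda>e. g e = 0"
      by unfold_locales simp
    obtain d L where L: "cycle (col d) L" "length L = 2 * q"
      using mono_even_cycle[of q] n NV by auto
    then have "\<exists>d. has_star d c n 2"
      using star_of_even_cycle[OF L NV n] c by blast
    then obtain d where d: "has_star d c n 2" by blast
    define i :: nat where "i = (if d then 0 else 1)"
    have colg: "g {u, v} = i" if "col d u v" for u v
    proof -
      have "{u, v} \<in> [{..<N}]\<^bsup>2\<^esup>" using that by (auto simp: col_def)
      then have "g {u, v} < 2" using g by auto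
      then show ?thesis using that by (auto simp: col_def i_def)
    qed
    obtain P D E where P: "P \<noteq> []" "length P = c" "distinct P" "successively (col d) P"
      and DE: "card D = n" "card E = 2" "D \<inter> E = {}" "(D \<union> E) \<inter> set P = {}"
      and hdD: "\<forall>a\<in>D. col d (hd P) a" and lastE: "\<forall>b\<in>E. col d (last P) b"
      using d unfolding has_star_def by blast
    have "finite D" "finite E" using DE n by (auto intro: card_ge_0_finite)
    then obtain h1 h2 where h: "bij_betw h1 {1..n} D" "bij_betw h2 {1..2::nat} E"
      using finite_same_card_bij[of "{1..n}" D] finite_same_card_bij[of "{1..2::nat}" E] DE by auto
    define \<phi> where "\<phi> v = (case v of A j \<Rightarrow> P ! (j - 1) | V j \<Rightarrow> h1 j | W j \<Rightarrow> h2 j)" for v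
    have \<phi>: "\<phi> (A j) = P ! (j - 1)" "\<phi> (V j) = h1 j" "\<phi> (W j) = h2 j" for j
      by (simp_all add: \<phi>_def)
    have nbr: "col d (P ! (j - 1)) (P ! j)" if "j \<in> {1..<c}" for j
      using that P by (cases j) (auto simp: successively_conv_nth)
    have h1D: "h1 j \<in> D" if "j \<in> {1..n}" for j using that h(1) by (auto simp: bij_betw_def)
    have h2E: "h2 j \<in> E" if "j \<in> {1..2}" for j using that h(2) by (auto simp: bij_betw_def)
    have ends: "hd P = P ! 0" "last P = P ! (c - 1)" using P by (simp_all add: hd_conv_nth last_conv_nth)
    have PA: "P ! (j - 1) \<in> set P" if "j \<in> {1..c}" for j using that P by auto
    have iA: "inj_on \<phi> (A ` {1..c})"
    proof (rule inj_onI)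
      fix u v assume "u \<in> A ` {1..c}" "v \<in> A ` {1..c}" and eq: "\<phi> u = \<phi> v"
      then obtain j k where jk: "u = A j" "v = A k" "j \<in> {1..c}" "k \<in> {1..c}" by blast
      then have "j - 1 = k - 1" using eq P(2,3) nth_eq_iff_index_eq[of P "j - 1" "k - 1"] by (auto simp: \<phi>)
      then show "u = v" using jk by auto
    qed
    have iVW: "inj_on \<phi> (V ` {1..n})" "inj_on \<phi> (W ` {1..2})"
      using h by (intro inj_on_imageI, simp add: comp_def \<phi> bij_betw_def)+
    have im: "\<phi> ` A ` {1..c} \<subseteq> set P" "\<phi> ` V ` {1..n} \<subseteq> D" "\<phi> ` W ` {1..2} \<subseteq> E"
      using PA h1D h2E by (auto simp: \<phi>)
    have dj: "\<phi> ` A ` {1..c} \<inter> \<phi> ` V ` {1..n} = {}"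
      "\<phi> ` (A ` {1..c} \<union> V ` {1..n}) \<inter> \<phi> ` W ` {1..2} = {}"
      using im DE(3,4) unfolding image_Un by blast+
    have un: "inj_on \<phi> (S \<union> T)" if "inj_on \<phi> S" "inj_on \<phi> T" "\<phi> ` S \<inter> \<phi> ` T = {}" for S T
      using that unfolding inj_on_Un by blast
    have "inj_on \<phi> (A ` {1..c} \<union> V ` {1..n} \<union> W ` {1..2})"
      by (intro un iA iVW dj)
    moreover have "\<phi> ` (A ` {1..c} \<union> V ` {1..n} \<union> W ` {1..2}) \<subseteq> {..<N}"
    proof -
      have "D \<subseteq> {..<N}" "E \<subseteq> {..<N}" using hdD lastE by (auto simp: col_def)
      moreover have "set P \<subseteq> {..<N}"
      proof
        fix x assume "x \<in> set P"
        then obtain j where j: "j < c" "x = P ! j" using P by (auto simp: in_set_conv_nth)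
        show "x \<in> {..<N}"
        proof (cases "Suc j < c")
          case True
          then have "col d (P ! j) (P ! Suc j)" using P by (simp add: successively_conv_nth)
          then show ?thesis using j by (simp add: col_def)
        next
          case False
          \<comment> \<open>The last vertex has no successor on \<open>P\<close>; it lies in
            \<open>{..<N}\<close> because it has a leaf, namely \<open>h2 1\<close>.\<close>
          then have "j = c - 1" using j(1) by simp
          then have "x = last P" using j(2) ends by simp
          then show ?thesis using h2E[of 1] lastE by (auto simp: col_def)
        qed
      qed
      ultimately have "set P \<union> D \<union> E \<subseteq> {..<N}" by (intro Un_least)
      moreover have "\<phi> ` (A ` {1..c} \<union> V ` {1..n} \<union> W ` {1..2}) \<subseteq> set P \<union> D \<union> E"
        unfolding image_Un by (intro Un_mono im)
      ultimately show ?thesis by (rule subset_trans[rotated])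
    qed
    moreover have "g (\<phi> ` e) = i" if "e \<in> snd (linked_double_star c n 2)" for e
    proof -
      from that consider j where "j \<in> {1..n}" "e = {A 1, V j}" | j where "j \<in> {1..<c}" "e = {A j, A (j + 1)}"
        | j where "j \<in> {1..2}" "e = {A c, W j}"
        unfolding linked_double_star_def by auto
      then show ?thesis
      proof cases
        case 1
        then show ?thesis using hdD h1D ends by (auto simp: \<phi> intro: colg)
      next
        case 2
        then show ?thesis using nbr[of j] by (auto simp: \<phi> intro: colg)
      next
        case 3
        then show ?thesis using lastE h2E ends by (auto simp: \<phi> intro: colg)
      qed
    qed
    moreover have "fst (linked_double_star c n 2) = A ` {1..c} \<union> V ` {1..n} \<union> W ` {1..2}"
      by (simp add: linked_double_star_def)
    moreover have "i < 2" by (simp add: i_def)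
    ultimately show ?thesis unfolding mono_copy_def by metis
  qed
  then show ?thesis
    unfolding ramsey_number_def N_def[symmetric] by (intro Least_le) blast
qed

end
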